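(* Let $G$ be a finite group with supercharacter theory $S$, and let $H,N$ be $S$-normal subgroups of $G$. Then (1) $H\leq U(S\mid N)$ if and only if $S$ is a $\Delta$-product over $H$ and $N$. (2) $N=U(S\mid N)$ if and only if $S$ is a $\ast$-product over $N$.
   Context: $\mathrm{Irr}(G)$ is the set of complex irreducible characters of the finite group $G$. A supercharacter theory $S$ of $G$ is a pair $(\mathcal X,\mathcal Y)$, where $\mathcal X$ is a partition of $\mathrm{Irr}(G)$ and $\mathcal Y$ is a partition of $G$, such that $\{1\}\in\mathcal Y$, $|\mathcal X|=|\mathcal Y|$, and for each $X\in\mathcal X$ the character $\sigma_X=\sum_{\chi\in X}\chi(1)\chi$ is constant on each $Y\in\mathcal Y$. The parts $Y\in\mathcal Y$ are the $S$-classes, the characters $\sigma_X$ are the $S$-characters, and $\mathrm{Irr}(S)=\{\sigma_X: X\in\mathcal X\}$. For a character $\chi$, $\ker(\chi)=\{g\in G:\chi(g)=\chi(1)\}$. A subgroup $N\le G$ is $S$-normal if it is a union of $S$-classes. For $N$ $S$-normal, $\mathrm{Irr}(S\mid N)$ is the set of $\chi\in\mathrm{Irr}(S)$ with $N\not\le\ker(\chi)$; $V(S\mid N)=\langle g\in G: \text{there exists }\chi\in\mathrm{Irr}(S\mid N)\text{ with }\chi(g)\ne0\rangle$; and $U(S\mid N)$ is the product of all $S$-normal subgroups $K$ of $G$ such that $V(S\mid K)\le N$. For $S$-normal subgroups $M,N$ of $G$, "$S$ is a $\Delta$-product over $M$ and $N$" means that $M\le N$ and every $S$-class lying outside of $N$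 is a union of full $M$-cosets. "$S$ is a $\ast$-product over $N$" means that every $S$-class lying outside of $N$ is a union of full $N$-cosets. *)

theory Defs
  imports
    "HOL-Algebra.Generated_Groups"
    "HOL-Algebra.Zassenhaus"
    "HOL-Library.Disjoint_Sets"
    "Jordan_Normal_Form.VS_Connect"
begin

section \<open>Complex irreducible characters\<close>

text \<open>The unit group of the ring of complex \<open>n\<close> by \<open>n\<close> matrices is \<open>GL\<^sub>n(\<complex>)\<close>.\<close>

definition representation ::
    "('a, 'b) monoid_scheme \<Rightarrow> nat \<Rightarrow> ('a \<Rightarrow> complex mat) \<Rightarrow> bool" where
  "representation G n \<rho> \<longleftrightarrow> \<rho> \<in> hom G (units_of (ring_mat TYPE(complex) n ()))"

definition irreducible_representation ::
    "('a, 'b) monoid_scheme \<Rightarrow> nat \<Rightarrow> ('a \<Rightarrow> complex mat) \<Rightarrow> bool" where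
  "irreducible_representation G n \<rho> \<longleftrightarrow>
     representation G n \<rho> \<and> 0 < n \<and>
     (\<forall>W. VectorSpace.subspace class_ring W (module_vec TYPE(complex) n) \<and>
          (\<forall>g\<in>carrier G. \<forall>w\<in>W. \<rho> g *\<^sub>v w \<in> W) \<longrightarrow>
          W = {0\<^sub>v n} \<or> W = carrier_vec n)"

text \<open>Characters are extended by \<open>0\<close> outside the carrier, so that characters which agree on the
  group are equal as functions.\<close>

definition character ::
    "('a, 'b) monoid_scheme \<Rightarrow> ('a \<Rightarrow> complex mat) \<Rightarrow> 'a \<Rightarrow> complex" where
  "character G \<rho> = (\<lambda>g. if g \<in> carrier G then sum_list (diag_mat (\<rho> g)) else 0)"

definition Irr :: "('a, 'b) monoid_scheme \<Rightarrow> ('a \<Rightarrow> complex) set" where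
  "Irr G = {character G \<rho> | n \<rho>. irreducible_representation G n \<rho>}"

definition char_kernel :: "('a, 'b) monoid_scheme \<Rightarrow> ('a \<Rightarrow> complex) \<Rightarrow> 'a set" where
  "char_kernel G \<chi> = {g \<in> carrier G. \<chi> g = \<chi> \<one>\<^bsub>G\<^esub>}"

section \<open>Supercharacter theories\<close>

definition sigma_char ::
    "('a, 'b) monoid_scheme \<Rightarrow> ('a \<Rightarrow> complex) set \<Rightarrow> 'a \<Rightarrow> complex" where
  "sigma_char G X = (\<lambda>g. \<Sum>\<chi>\<in>X. \<chi> \<one>\<^bsub>G\<^esub> * \<chi> g)"

type_synonym 'a supchar_pair = "('a \<Rightarrow> complex) set set \<times> 'a set set"

definition supercharacter_theory ::
    "('a, 'b) monoid_scheme \<Rightarrow> 'a supchar_pair \<Rightarrow> bool" where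
  "supercharacter_theory G S \<longleftrightarrow> (case S of (\<X>, \<Y>) \<Rightarrow>
     partition_on (Irr G) \<X> \<and>
     partition_on (carrier G) \<Y> \<and>
     {\<one>\<^bsub>G\<^esub>} \<in> \<Y> \<and>
     card \<X> = card \<Y> \<and>
     (\<forall>X\<in>\<X>. \<forall>Y\<in>\<Y>. \<forall>g\<in>Y. \<forall>h\<in>Y. sigma_char G X g = sigma_char G X h))"

definition S_classes :: "'a supchar_pair \<Rightarrow> 'a set set" where
  "S_classes S = snd S"

definition S_characters ::
    "('a, 'b) monoid_scheme \<Rightarrow> 'a supchar_pair \<Rightarrow> ('a \<Rightarrow> complex) set" where
  "S_characters G S = sigma_char G ` fst S"

definition S_normal ::
    "('a, 'b) monoid_scheme \<Rightarrow> 'a supchar_pair \<Rightarrow> 'a set \<Rightarrow> bool" where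
  "S_normal G S N \<longleftrightarrow> subgroup N G \<and> (\<exists>\<C> \<subseteq> S_classes S. N = \<Union>\<C>)"

definition S_characters_over ::
    "('a, 'b) monoid_scheme \<Rightarrow> 'a supchar_pair \<Rightarrow> 'a set \<Rightarrow> ('a \<Rightarrow> complex) set" where
  "S_characters_over G S N = {\<chi> \<in> S_characters G S. \<not> N \<subseteq> char_kernel G \<chi>}"

definition V_sub ::
    "('a, 'b) monoid_scheme \<Rightarrow> 'a supchar_pair \<Rightarrow> 'a set \<Rightarrow> 'a set" where
  "V_sub G S N = generate G {g \<in> carrier G. \<exists>\<chi>\<in>S_characters_over G S N. \<chi> g \<noteq> 0}"

text \<open>The product \<open>K\<^sub>1 K\<^sub>2 \<dots> K\<^sub>r\<close> of a finite family of subgroups, taken in an arbitrary order. The order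
  is irrelevant when the subgroups are normal (lemma \<open>subgroups_product_eq\<close>), which is the case
  for the \<open>S\<close>-normal subgroups of a supercharacter theory \<open>S\<close>.\<close>

definition subgroups_product :: "('a, 'b) monoid_scheme \<Rightarrow> 'a set set \<Rightarrow> 'a set" where
  "subgroups_product G \<F> =
     foldr (\<lambda>K P. K <#>\<^bsub>G\<^esub> P) (SOME Ks. distinct Ks \<and> set Ks = \<F>) {\<one>\<^bsub>G\<^esub>}"

lemma (in group) foldr_set_mult_normal:
  assumes "\<And>K. K \<in> set Ks \<Longrightarrow> K \<lhd> G"
  shows "subgroup (foldr (\<lambda>K P. K <#> P) Ks {\<one>}) G"
    and "foldr (\<lambda>K P. K <#> P) Ks {\<one>} = generate G (\<Union>(set Ks))"
proof -
  have "subgroup (foldr (\<lambda>K P. K <#> P) Ks {\<one>}) G \<and>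
        \<Union>(set Ks) \<subseteq> foldr (\<lambda>K P. K <#> P) Ks {\<one>} \<and>
        foldr (\<lambda>K P. K <#> P) Ks {\<one>} \<subseteq> generate G (\<Union>(set Ks))"
    using assms
  proof (induction Ks)
    case Nil
    show ?case using triv_subgroup by (auto intro: generate.one)
  next
    case (Cons K Ks)
    let ?P = "foldr (\<lambda>K P. K <#> P) Ks {\<one>}"
    have K: "K \<lhd> G" and P: "subgroup ?P G" and sub: "\<Union>(set Ks) \<subseteq> ?P"
      and gen: "?P \<subseteq> generate G (\<Union>(set Ks))"
      using Cons by auto
    have Ksub: "subgroup K G" using K by (rule normal_imp_subgroup)
    have "subgroup (K <#> ?P) G"
      using K P by (rule mult_norm_subgroup)
    moreover have "K \<subseteq> K <#> ?P"
      using subgroup.one_closed[OF P] subgroup.subset[OF Ksub] r_one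
      unfolding set_mult_def by force
    moreover have "?P \<subseteq> K <#> ?P"
      using subgroup.one_closed[OF Ksub] subgroup.subset[OF P] l_one
      unfolding set_mult_def by force
    moreover have "K <#> ?P \<subseteq> generate G (\<Union>(set (K # Ks)))"
    proof
      fix x assume "x \<in> K <#> ?P"
      then obtain k p where x: "x = k \<otimes> p" "k \<in> K" "p \<in> ?P"
        unfolding set_mult_def by auto
      have "p \<in> generate G (\<Union>(set (K # Ks)))"
        using x(3) gen mono_generate[of "\<Union>(set Ks)" "\<Union>(set (K # Ks))"] by auto
      moreover have "k \<in> generate G (\<Union>(set (K # Ks)))"
        using x(2) by (auto intro: generate.incl)
      ultimately show "x \<in> generate G (\<Union>(set (K # Ks)))"
        using x(1) by (auto intro: generate.eng)
    qed
    ultimately show ?case using sub by auto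
  qed
  then show sub: "subgroup (foldr (\<lambda>K P. K <#> P) Ks {\<one>}) G"
    and "foldr (\<lambda>K P. K <#> P) Ks {\<one>} = generate G (\<Union>(set Ks))"
    using generate_subgroup_incl by (blast, metis subset_antisym)
qed

lemma (in group) subgroups_product_eq:
  assumes "\<And>K. K \<in> set Ks \<Longrightarrow> K \<lhd> G"
  shows "subgroups_product G (set Ks) = foldr (\<lambda>K P. K <#> P) Ks {\<one>}"
proof -
  let ?Ls = "SOME Ls. distinct Ls \<and> set Ls = set Ks"
  have Ls: "set ?Ls = set Ks"
    using someI_ex[of "\<lambda>Ls. distinct Ls \<and> set Ls = set Ks"] finite_distinct_list[of "set Ks"]
    by auto
  show ?thesis
    using foldr_set_mult_normal(2)[of ?Ls] foldr_set_mult_normal(2)[of Ks] assms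
    unfolding subgroups_product_def Ls by simp
qed

definition U_sub ::
    "('a, 'b) monoid_scheme \<Rightarrow> 'a supchar_pair \<Rightarrow> 'a set \<Rightarrow> 'a set" where
  "U_sub G S N = subgroups_product G {K. S_normal G S K \<and> V_sub G S K \<subseteq> N}"

definition union_of_cosets :: "('a, 'b) monoid_scheme \<Rightarrow> 'a set \<Rightarrow> 'a set \<Rightarrow> bool" where
  "union_of_cosets G M Y \<longleftrightarrow> (\<exists>\<C> \<subseteq> rcosets\<^bsub>G\<^esub> M. Y = \<Union>\<C>)"

definition Delta_product ::
    "('a, 'b) monoid_scheme \<Rightarrow> 'a supchar_pair \<Rightarrow> 'a set \<Rightarrow> 'a set \<Rightarrow> bool" where
  "Delta_product G S M N \<longleftrightarrow>
     M \<subseteq> N \<and> (\<forall>Y\<in>S_classes S. Y \<inter> N = {} \<longrightarrow> union_of_cosets G M Y)"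

definition star_product ::
    "('a, 'b) monoid_scheme \<Rightarrow> 'a supchar_pair \<Rightarrow> 'a set \<Rightarrow> bool" where
  "star_product G S N \<longleftrightarrow> (\<forall>Y\<in>S_classes S. Y \<inter> N = {} \<longrightarrow> union_of_cosets G N Y)"

end

theory Submission
  imports Defs "Jordan_Normal_Form.Spectral_Radius"
begin

text \<open>
  Everything follows from one equivalence for \<open>S\<close>-normal subgroups \<open>K\<close> and \<open>N\<close>
  (\<open>V_sub_le_iff_Delta_product\<close>): \<open>V(S | K) \<le> N\<close> holds if and only if \<open>S\<close> is a
  \<open>\<Delta>\<close>-product over \<open>K\<close> and \<open>N\<close>. Two facts about the \<open>S\<close>-characters are behind it.

  \<^item> They separate the \<open>S\<close>-classes (\<open>sigma_separates_classes\<close>). Indeed they are orthogonal, and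
    there are as many of them as classes, so that they span the functions that are constant on
    the \<open>S\<close>-classes.
  \<^item> For \<open>S\<close>-normal \<open>K\<close>, an \<open>S\<close>-character with \<open>K\<close> in its kernel is constant on the cosets of
    \<open>K\<close>, and every other \<open>S\<close>-character has sum \<open>0\<close> over each coset
    (\<open>sigma_S_normal_dichotomy\<close>). For a single irreducible character this is Schur's lemma,
    applied to the sum of the representing matrices over \<open>K\<close>. It passes to
    \<open>\<sigma>\<^sub>X\<close> because the indicator function of \<open>K\<close> is a combination of \<open>S\<close>-characters:
    comparing inner products shows that \<open>(\<Sum>k\<in>K. \<psi>(k)) / \<psi>(1)\<close> is the same for all \<open>\<psi> \<in> X\<close>,
    so that all members of \<open>X\<close> are of the same kind.

  Suppose that \<open>V(S | K) \<le> N\<close>, and let \<open>g\<close> lie outside \<open>N\<close>. Then \<open>K \<le> N\<close>, because \<open>K \<le> V(S | K)\<close>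
  (\<open>S_normal_le_V_sub\<close>), so all of \<open>Kg\<close> lies outside \<open>N\<close>. The \<open>S\<close>-characters with \<open>K\<close> in the
  kernel are constant on \<open>Kg\<close>, the others vanish there, and hence \<open>Kg\<close> lies in a single
  \<open>S\<close>-class. Conversely, if the \<open>S\<close>-classes outside \<open>N\<close> are unions of \<open>K\<close>-cosets, then every
  \<open>S\<close>-character is constant on such a coset; if \<open>K\<close> is not in its kernel, the sum over the
  coset is \<open>0\<close>, so it vanishes outside \<open>N\<close>.

  The \<open>S\<close>-normal subgroups are normal, hence \<open>U(S | N)\<close> is generated by the \<open>K\<close> with
  \<open>V(S | K) \<le> N\<close>. Being stable under multiplication by each such \<open>K\<close> is the same as being stable
  under \<open>U(S | N)\<close>, which yields the first claim; the second is the case \<open>H = N\<close>, as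
  \<open>U(S | N) \<le> N\<close>.

  The required character theory is the first orthogonality relation and the finiteness
  of the set of irreducible characters; both are derived from Schur's lemma for matrices.
\<close>

section \<open>Traces and sums of complex matrices\<close>

definition tr :: "complex mat \<Rightarrow> complex" where
  "tr A = sum_list (diag_mat A)"

lemma tr_eq_sum: "A \<in> carrier_mat n n \<Longrightarrow> tr A = (\<Sum>i<n. A $$ (i, i))"
  unfolding tr_def diag_mat_def by (simp add: sum_list_sum_nth atLeast0LessThan)

lemma tr_comm:
  assumes A: "A \<in> carrier_mat n m" and B: "B \<in> carrier_mat m n"
  shows "tr (A * B) = tr (B * A)"
proof -
  have "tr (A * B) = (\<Sum>i<n. \<Sum>j<m. A $$ (i, j) * B $$ (j, i))"
    using A B by (subst tr_eq_sum[of _ n]) (auto simp: scalar_prod_def atLeast0LessThan)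
  also have "\<dots> = (\<Sum>j<m. \<Sum>i<n. B $$ (j, i) * A $$ (i, j))"
    by (subst sum.swap) (simp add: mult.commute)
  also have "\<dots> = tr (B * A)"
    using A B by (subst tr_eq_sum[of _ m]) (auto simp: scalar_prod_def atLeast0LessThan)
  finally show ?thesis .
qed

lemma tr_one: "tr (1\<^sub>m n) = of_nat n"
  by (subst tr_eq_sum[of _ n]) auto

lemma tr_smult: "A \<in> carrier_mat n n \<Longrightarrow> tr (c \<cdot>\<^sub>m A) = c * tr A"
  by (subst (1 2) tr_eq_sum[of _ n]) (auto simp: sum_distrib_left)

text \<open>The size is an explicit argument, so that sums over empty index sets are matrices of the right
  shape.\<close>

definition mat_sum :: "nat \<Rightarrow> nat \<Rightarrow> ('i \<Rightarrow> complex mat) \<Rightarrow> 'i set \<Rightarrow> complex mat" where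
  "mat_sum n m f I = mat n m (\<lambda>ij. \<Sum>g\<in>I. f g $$ ij)"

lemma mat_sum_carrier [simp]: "mat_sum n m f I \<in> carrier_mat n m"
  unfolding mat_sum_def by simp

lemma index_mat_sum [simp]:
  "i < n \<Longrightarrow> j < m \<Longrightarrow> mat_sum n m f I $$ (i, j) = (\<Sum>g\<in>I. f g $$ (i, j))"
  unfolding mat_sum_def by simp

lemma mat_sum_cong:
  "(\<And>g. g \<in> I \<Longrightarrow> f g = f' g) \<Longrightarrow> mat_sum n m f I = mat_sum n m f' I"
  unfolding mat_sum_def by (intro cong_mat) auto

lemma mat_sum_reindex:
  "bij_betw b I J \<Longrightarrow> mat_sum n m f J = mat_sum n m (\<lambda>g. f (b g)) I"
  unfolding mat_sum_def by (intro cong_mat refl sum.reindex_bij_betw[symmetric])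

lemma mult_mat_sum:
  assumes P: "P \<in> carrier_mat k n" and f: "\<And>g. g \<in> I \<Longrightarrow> f g \<in> carrier_mat n m"
  shows "P * mat_sum n m f I = mat_sum k m (\<lambda>g. P * f g) I"
proof (rule eq_matI)
  fix i j assume "i < dim_row (mat_sum k m (\<lambda>g. P * f g) I)"
    and "j < dim_col (mat_sum k m (\<lambda>g. P * f g) I)"
  then have ij: "i < k" "j < m" unfolding mat_sum_def by auto
  have "(P * mat_sum n m f I) $$ (i, j) = (\<Sum>l<n. P $$ (i, l) * (\<Sum>g\<in>I. f g $$ (l, j)))"
    using ij P carrier_matD[OF mat_sum_carrier[of n m f I]]
    by (simp add: scalar_prod_def atLeast0LessThan)
  also have "\<dots> = (\<Sum>g\<in>I. \<Sum>l<n. P $$ (i, l) * f g $$ (l, j))"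
    by (subst sum.swap) (simp add: sum_distrib_left)
  also have "\<dots> = (\<Sum>g\<in>I. (P * f g) $$ (i, j))"
    using ij P carrier_matD[OF f]
    by (intro sum.cong refl) (simp add: scalar_prod_def atLeast0LessThan)
  finally show "(P * mat_sum n m f I) $$ (i, j) = mat_sum k m (\<lambda>g. P * f g) I $$ (i, j)"
    using ij by simp
qed (use P in \<open>auto simp: mat_sum_def\<close>)

lemma mat_sum_mult:
  assumes P: "P \<in> carrier_mat m k" and f: "\<And>g. g \<in> I \<Longrightarrow> f g \<in> carrier_mat n m"
  shows "mat_sum n m f I * P = mat_sum n k (\<lambda>g. f g * P) I"
proof (rule eq_matI)
  fix i j assume "i < dim_row (mat_sum n k (\<lambda>g. f g * P) I)"
    and "j < dim_col (mat_sum n k (\<lambda>g. f g * P) I)"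
  then have ij: "i < n" "j < k" unfolding mat_sum_def by auto
  have "(mat_sum n m f I * P) $$ (i, j) = (\<Sum>l<m. (\<Sum>g\<in>I. f g $$ (i, l)) * P $$ (l, j))"
    using ij P carrier_matD[OF mat_sum_carrier[of n m f I]]
    by (simp add: scalar_prod_def atLeast0LessThan)
  also have "\<dots> = (\<Sum>g\<in>I. \<Sum>l<m. f g $$ (i, l) * P $$ (l, j))"
    by (subst sum.swap) (simp add: sum_distrib_right)
  also have "\<dots> = (\<Sum>g\<in>I. (f g * P) $$ (i, j))"
    using ij P carrier_matD[OF f]
    by (intro sum.cong refl) (simp add: scalar_prod_def atLeast0LessThan)
  finally show "(mat_sum n m f I * P) $$ (i, j) = mat_sum n k (\<lambda>g. f g * P) I $$ (i, j)"
    using ij by simp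
qed (use P in \<open>auto simp: mat_sum_def\<close>)

lemma tr_mat_sum:
  assumes "\<And>g. g \<in> I \<Longrightarrow> f g \<in> carrier_mat n n"
  shows "tr (mat_sum n n f I) = (\<Sum>g\<in>I. tr (f g))"
proof -
  have "tr (mat_sum n n f I) = (\<Sum>g\<in>I. \<Sum>i<n. f g $$ (i, i))"
    by (subst tr_eq_sum[of _ n]) (auto intro: sum.swap)
  then show ?thesis using assms by (simp add: tr_eq_sum[of _ n])
qed

text \<open>Matrix units in the middle of a product pick out single matrix entries of the outer factors;
  this turns statements about averaged intertwiners into statements about characters.\<close>

lemma mult_mat_unit_entry:
  fixes A B :: "complex mat"
  assumes A: "A \<in> carrier_mat n n" and B: "B \<in> carrier_mat m m"
    and "i < n" "j < n" "k < m" "l < m"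
  shows "(A * mat n m (\<lambda>ij. if ij = (j, k) then 1 else 0) * B) $$ (i, l) = A $$ (i, j) * B $$ (k, l)"
proof -
  let ?E = "mat n m (\<lambda>ij. if ij = (j, k) then 1 else 0) :: complex mat"
  have 1: "(A * ?E) $$ (i, q) = (if q = k then A $$ (i, j) else 0)" if "q < m" for q
  proof -
    have "(A * ?E) $$ (i, q) = (\<Sum>p<n. A $$ (i, p) * (if p = j \<and> q = k then 1 else 0))"
      using that assms by (simp add: scalar_prod_def atLeast0LessThan)
    also have "\<dots> = (\<Sum>p<n. if p = j then (if q = k then A $$ (i, j) else 0) else 0)"
      by (intro sum.cong) auto
    finally show ?thesis using assms by simp
  qed
  have "(A * ?E * B) $$ (i, l) = (\<Sum>q<m. (A * ?E) $$ (i, q) * B $$ (q, l))"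
    using assms by (simp add: scalar_prod_def atLeast0LessThan)
  also have "\<dots> = (\<Sum>q<m. if q = k then A $$ (i, j) * B $$ (k, l) else 0)"
    by (intro sum.cong) (auto simp: 1)
  finally show ?thesis using assms by simp
qed

section \<open>Schur's lemma\<close>

lemma mat_eq_zeroI:
  fixes T :: "complex mat"
  assumes T: "T \<in> carrier_mat n m" and Tv: "\<And>v. v \<in> carrier_vec m \<Longrightarrow> T *\<^sub>v v = 0\<^sub>v n"
  shows "T = 0\<^sub>m n m"
proof (rule eq_matI)
  fix i j assume "i < dim_row (0\<^sub>m n m :: complex mat)" "j < dim_col (0\<^sub>m n m :: complex mat)"
  then have ij: "i < n" "j < m" by auto
  then have "(T *\<^sub>v unit_vec m j) $ i = 0" using Tv[of "unit_vec m j"] by simp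
  then show "T $$ (i, j) = 0\<^sub>m n m $$ (i, j)"
    using ij T by (simp add: scalar_prod_right_unit)
qed (use T in auto)

context group begin

lemma representationD:
  assumes "representation G n \<rho>"
  shows "g \<in> carrier G \<Longrightarrow> \<rho> g \<in> carrier_mat n n"
    and "g \<in> carrier G \<Longrightarrow> h \<in> carrier G \<Longrightarrow> \<rho> (g \<otimes> h) = \<rho> g * \<rho> h"
    and "\<rho> \<one> = 1\<^sub>m n"
proof -
  let ?R = "ring_mat TYPE(complex) n ()"
  interpret R: ring ?R by (rule ring_mat)
  have hom: "\<rho> \<in> hom G (units_of ?R)" using assms unfolding representation_def .
  interpret group_hom G "units_of ?R" \<rho>
    by (intro group_hom.intro group_hom_axioms.intro is_group R.units_group hom)
  show "g \<in> carrier G \<Longrightarrow> \<rho> g \<in> carrier_mat n n"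
    using hom_closed[of g] by (auto simp: units_of_carrier Units_def ring_mat_def)
  show "g \<in> carrier G \<Longrightarrow> h \<in> carrier G \<Longrightarrow> \<rho> (g \<otimes> h) = \<rho> g * \<rho> h"
    using hom_mult[of g h] by (simp add: units_of_mult ring_mat_def)
  show "\<rho> \<one> = 1\<^sub>m n"
    using hom_one by (simp add: units_of_one ring_mat_def)
qed

end

lemma subspace_of_vectorsI:
  assumes "W \<subseteq> carrier_vec n" "0\<^sub>v n \<in> W"
    and "\<And>v w. v \<in> W \<Longrightarrow> w \<in> W \<Longrightarrow> v + w \<in> W"
    and "\<And>(c::complex) v. v \<in> W \<Longrightarrow> c \<cdot>\<^sub>v v \<in> W"
  shows "VectorSpace.subspace class_ring W (module_vec TYPE(complex) n)"
proof -
  interpret V: vec_space "TYPE(complex)" n .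
  show ?thesis
    unfolding VectorSpace.subspace_def submodule_def
    using assms V.vectorspace_axioms V.module_axioms
    by (auto simp: module_vec_simps)
qed

definition intertwines ::
    "('a, 'b) monoid_scheme \<Rightarrow> ('a \<Rightarrow> complex mat) \<Rightarrow> ('a \<Rightarrow> complex mat) \<Rightarrow> complex mat \<Rightarrow> bool"
  where
  "intertwines G \<rho> \<sigma> T \<longleftrightarrow> (\<forall>g\<in>carrier G. \<rho> g * T = T * \<sigma> g)"

context group begin

text \<open>The kernel of \<open>T\<close> is an invariant subspace for \<open>\<sigma>\<close>. As it contains \<open>v\<close>, irreducibility makes it
  the whole space.\<close>

lemma singular_intertwiner_eq_zero:
  assumes irr: "irreducible_representation G m \<sigma>" and rho: "representation G n \<rho>"
    and T: "T \<in> carrier_mat n m" and int: "intertwines G \<rho> \<sigma> T"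
    and v: "v \<in> carrier_vec m" "v \<noteq> 0\<^sub>v m" "T *\<^sub>v v = 0\<^sub>v n"
  shows "T = 0\<^sub>m n m"
proof -
  have sig: "representation G m \<sigma>" using irr unfolding irreducible_representation_def by simp
  let ?W = "{w \<in> carrier_vec m. T *\<^sub>v w = 0\<^sub>v n}"
  have "VectorSpace.subspace class_ring ?W (module_vec TYPE(complex) m)"
    using T by (intro subspace_of_vectorsI)
      (auto simp: mult_add_distrib_mat_vec[OF T] mult_mat_vec[OF T])
  moreover have "\<sigma> g *\<^sub>v w \<in> ?W" if g: "g \<in> carrier G" and w: "w \<in> ?W" for g w
  proof -
    have c: "\<sigma> g \<in> carrier_mat m m" "\<rho> g \<in> carrier_mat n n"
      using representationD(1)[OF sig g] representationD(1)[OF rho g] by auto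
    have "T *\<^sub>v (\<sigma> g *\<^sub>v w) = (\<rho> g * T) *\<^sub>v w"
      using int g w T c unfolding intertwines_def by simp
    also have "\<dots> = \<rho> g *\<^sub>v 0\<^sub>v n" using assoc_mult_mat_vec[OF c(2) T, of w] w by simp
    also have "\<dots> = 0\<^sub>v n" using c by auto
    finally show ?thesis using w c by auto
  qed
  ultimately have "?W = {0\<^sub>v m} \<or> ?W = carrier_vec m"
    using irr unfolding irreducible_representation_def by blast
  then have "?W = carrier_vec m" using v by blast
  then show ?thesis using T by (intro mat_eq_zeroI) blast+
qed

text \<open>The image of \<open>T\<close> is a nonzero invariant subspace for \<open>\<rho>\<close>, hence the whole space.\<close>

lemma nonzero_intertwiner_surjective:
  assumes irr: "irreducible_representation G n \<rho>" and sig: "representation G m \<sigma>"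
    and T: "T \<in> carrier_mat n m" and int: "intertwines G \<rho> \<sigma> T" and nz: "T \<noteq> 0\<^sub>m n m"
    and w: "w \<in> carrier_vec n"
  shows "\<exists>v\<in>carrier_vec m. T *\<^sub>v v = w"
proof -
  have rho: "representation G n \<rho>" using irr unfolding irreducible_representation_def by simp
  let ?W = "(\<lambda>v. T *\<^sub>v v) ` carrier_vec m"
  have "VectorSpace.subspace class_ring ?W (module_vec TYPE(complex) n)"
  proof (rule subspace_of_vectorsI)
    show "?W \<subseteq> carrier_vec n" using T by auto
    show "0\<^sub>v n \<in> ?W" using T by (intro image_eqI[of _ _ "0\<^sub>v m"]) auto
  next
    fix v w assume "v \<in> ?W" "w \<in> ?W"
    then obtain x y where "x \<in> carrier_vec m" "y \<in> carrier_vec m" "v = T *\<^sub>v x" "w = T *\<^sub>v y" by auto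
    then show "v + w \<in> ?W"
      by (intro image_eqI[of _ _ "x + y"]) (auto simp: mult_add_distrib_mat_vec[OF T])
  next
    fix c :: complex and v assume "v \<in> ?W"
    then obtain x where "x \<in> carrier_vec m" "v = T *\<^sub>v x" by auto
    then show "c \<cdot>\<^sub>v v \<in> ?W"
      by (intro image_eqI[of _ _ "c \<cdot>\<^sub>v x"]) (auto simp: mult_mat_vec[OF T])
  qed
  moreover have "\<rho> g *\<^sub>v w \<in> ?W" if g: "g \<in> carrier G" and w: "w \<in> ?W" for g w
  proof -
    have c: "\<sigma> g \<in> carrier_mat m m" "\<rho> g \<in> carrier_mat n n"
      using representationD(1)[OF sig g] representationD(1)[OF rho g] by auto
    obtain x where x: "x \<in> carrier_vec m" "w = T *\<^sub>v x" using w by auto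
    have "\<rho> g *\<^sub>v w = (\<rho> g * T) *\<^sub>v x" using x c T by simp
    also have "\<dots> = T *\<^sub>v (\<sigma> g *\<^sub>v x)"
      using int g x T c unfolding intertwines_def by simp
    finally show ?thesis using x c by auto
  qed
  ultimately have "?W = {0\<^sub>v n} \<or> ?W = carrier_vec n"
    using irr unfolding irreducible_representation_def by blast
  moreover have "?W \<noteq> {0\<^sub>v n}"
  proof
    assume W: "?W = {0\<^sub>v n}"
    have "T = 0\<^sub>m n m" using W T by (intro mat_eq_zeroI) blast+
    then show False using nz by simp
  qed
  ultimately have "w \<in> ?W" using w by simp
  then show ?thesis by (auto intro: sym)
qed

text \<open>Such a \<open>T\<close> is surjective and injective, hence has a two-sided inverse \<open>R\<close>, and
  \<open>\<rho>(g) = T \<sigma>(g) R\<close> has the same trace as \<open>\<sigma>(g)\<close>. The dimensions \<open>n\<close> and \<open>m\<close> agree as the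
  case \<open>g = 1\<close> of this.\<close>

lemma nonzero_intertwiner_imp_character_eq:
  assumes irr: "irreducible_representation G n \<rho>" "irreducible_representation G m \<sigma>"
    and T: "T \<in> carrier_mat n m" and int: "intertwines G \<rho> \<sigma> T" and nz: "T \<noteq> 0\<^sub>m n m"
  shows "character G \<rho> = character G \<sigma>"
proof -
  have rep: "representation G n \<rho>" "representation G m \<sigma>"
    using irr unfolding irreducible_representation_def by auto
  have "\<forall>j. \<exists>v\<in>carrier_vec m. T *\<^sub>v v = unit_vec n j"
    using nonzero_intertwiner_surjective[OF irr(1) rep(2) T int nz] by simp
  then obtain r where r: "\<And>j. r j \<in> carrier_vec m" "\<And>j. T *\<^sub>v r j = unit_vec n j" by metis
  define R where "R = mat m n (\<lambda>(i, j). r j $ i)"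
  have R: "R \<in> carrier_mat m n" unfolding R_def by simp
  have colR: "col R j = r j" if "j < n" for j
    using that r(1)[of j] unfolding R_def by (intro eq_vecI) auto
  have TR: "T * R = 1\<^sub>m n"
  proof (rule eq_matI)
    fix i j assume "i < dim_row (1\<^sub>m n :: complex mat)" "j < dim_col (1\<^sub>m n :: complex mat)"
    then have ij: "i < n" "j < n" by auto
    have "(T * R) $$ (i, j) = (T *\<^sub>v r j) $ i" using ij T R colR by simp
    then show "(T * R) $$ (i, j) = 1\<^sub>m n $$ (i, j)" using ij r(2)[of j] by simp
  qed (use T R in auto)
  \<comment> \<open>\<open>T (R T - 1) = 0\<close>, and \<open>T\<close> is injective.\<close>
  have RT: "R * T = 1\<^sub>m m"
  proof (rule eq_matI)
    fix i j assume "i < dim_row (1\<^sub>m m :: complex mat)" "j < dim_col (1\<^sub>m m :: complex mat)"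
    then have ij: "i < m" "j < m" by auto
    let ?v = "(R * T) *\<^sub>v unit_vec m j - unit_vec m j"
    have v: "?v \<in> carrier_vec m" using R T by auto
    have "T *\<^sub>v ((R * T) *\<^sub>v unit_vec m j) = (T * R) *\<^sub>v (T *\<^sub>v unit_vec m j)"
      using R T by simp
    also have "\<dots> = T *\<^sub>v unit_vec m j" using T by (subst TR) auto
    finally have "T *\<^sub>v ?v = 0\<^sub>v n"
      using R T by (subst mult_minus_distrib_mat_vec[OF T]) auto
    then have "?v = 0\<^sub>v m" using singular_intertwiner_eq_zero[OF irr(2) rep(1) T int v] nz by blast
    then have "?v $ i = 0" using ij by simp
    moreover have "((R * T) *\<^sub>v unit_vec m j) $ i = (R * T) $$ (i, j)"
    proof -
      have "((R * T) *\<^sub>v unit_vec m j) $ i = row (R * T) i \<bullet> unit_vec m j"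
        using ij T R by (intro index_mult_mat_vec) auto
      also have "\<dots> = row (R * T) i $ j"
        using ij T R by (intro scalar_prod_right_unit) auto
      finally show ?thesis using ij T R by simp
    qed
    ultimately show "(R * T) $$ (i, j) = 1\<^sub>m m $$ (i, j)"
      using ij T R by (simp del: index_mult_mat_vec)
  qed (use T R in auto)
  show ?thesis
  proof
    fix g
    show "character G \<rho> g = character G \<sigma> g"
    proof (cases "g \<in> carrier G")
      case True
      have c: "\<sigma> g \<in> carrier_mat m m" "\<rho> g \<in> carrier_mat n n"
        using representationD(1)[OF rep(1) True] representationD(1)[OF rep(2) True] by auto
      have "\<rho> g = \<rho> g * (T * R)" using c by (simp add: TR)
      also have "\<dots> = (\<rho> g * T) * R" by (rule assoc_mult_mat[symmetric, OF c(2) T R])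
      also have "\<rho> g * T = T * \<sigma> g"
        using int True unfolding intertwines_def by simp
      also have "T * \<sigma> g * R = T * (\<sigma> g * R)" by (rule assoc_mult_mat[OF T c(1) R])
      finally have "tr (\<rho> g) = tr (T * (\<sigma> g * R))" by simp
      also have "\<dots> = tr (\<sigma> g * R * T)" by (rule tr_comm[OF T]) (use c R in auto)
      also have "\<sigma> g * R * T = \<sigma> g * (R * T)" by (rule assoc_mult_mat[OF c(1) R T])
      also have "\<dots> = \<sigma> g" using c by (simp add: RT)
      finally show ?thesis using True unfolding character_def tr_def by simp
    qed (simp add: character_def)
  qed
qed

text \<open>Subtracting an eigenvalue times the identity from \<open>T\<close> gives a singular intertwiner, which has to
  vanish.\<close>

lemma self_intertwiner_scalar:
  assumes irr: "irreducible_representation G n \<rho>"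
    and T: "T \<in> carrier_mat n n" and int: "intertwines G \<rho> \<rho> T"
  shows "\<exists>c. T = c \<cdot>\<^sub>m 1\<^sub>m n"
proof -
  have rep: "representation G n \<rho>" and n: "0 < n"
    using irr unfolding irreducible_representation_def by auto
  obtain c where "c \<in> spectrum T" using spectrum_non_empty[OF T n] by auto
  then obtain v where v: "v \<in> carrier_vec n" "v \<noteq> 0\<^sub>v n" "T *\<^sub>v v = c \<cdot>\<^sub>v v"
    using T unfolding spectrum_def eigenvalue_def eigenvector_def by auto
  let ?S = "T - c \<cdot>\<^sub>m 1\<^sub>m n"
  have S: "?S \<in> carrier_mat n n" using T by auto
  have "?S *\<^sub>v v = T *\<^sub>v v - (c \<cdot>\<^sub>m 1\<^sub>m n) *\<^sub>v v"
    by (rule minus_mult_distrib_mat_vec[OF T _ v(1)]) simp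
  also have "(c \<cdot>\<^sub>m 1\<^sub>m n) *\<^sub>v v = c \<cdot>\<^sub>v v"
    using v(1) by (intro eq_vecI) auto
  finally have Sv: "?S *\<^sub>v v = 0\<^sub>v n" using v by simp
  have "intertwines G \<rho> \<rho> ?S"
    unfolding intertwines_def
  proof
    fix g assume g: "g \<in> carrier G"
    have c: "\<rho> g \<in> carrier_mat n n" using representationD(1)[OF rep g] .
    have "\<rho> g * ?S = \<rho> g * T - \<rho> g * (c \<cdot>\<^sub>m 1\<^sub>m n)"
      by (rule mult_minus_distrib_mat[OF c T]) simp
    also have "\<rho> g * (c \<cdot>\<^sub>m 1\<^sub>m n) = (c \<cdot>\<^sub>m 1\<^sub>m n) * \<rho> g"
      using c by (simp add: mult_smult_distrib[OF c one_carrier_mat]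
          mult_smult_assoc_mat[OF one_carrier_mat c])
    also have "\<rho> g * T = T * \<rho> g" using int g unfolding intertwines_def by simp
    also have "T * \<rho> g - (c \<cdot>\<^sub>m 1\<^sub>m n) * \<rho> g = ?S * \<rho> g"
      by (rule minus_mult_distrib_mat[symmetric, OF T _ c]) simp
    finally show "\<rho> g * ?S = ?S * \<rho> g" .
  qed
  then have S0: "?S = 0\<^sub>m n n"
    using singular_intertwiner_eq_zero[OF irr rep S _ v(1,2) Sv] by blast
  have "T = c \<cdot>\<^sub>m 1\<^sub>m n"
  proof (rule eq_matI)
    fix i j assume "i < dim_row (c \<cdot>\<^sub>m 1\<^sub>m n)" "j < dim_col (c \<cdot>\<^sub>m 1\<^sub>m n)"
    then show "T $$ (i, j) = (c \<cdot>\<^sub>m 1\<^sub>m n) $$ (i, j)"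
      using arg_cong[OF S0, of "\<lambda>A. A $$ (i, j)"] T by simp
  qed (use T in auto)
  then show ?thesis by blast
qed

end

section \<open>Irreducible characters\<close>

context group begin

lemma character_eq_tr: "g \<in> carrier G \<Longrightarrow> character G \<rho> g = tr (\<rho> g)"
  unfolding character_def tr_def by simp

lemma bij_betw_left_mult:
  assumes "h \<in> carrier G"
  shows "bij_betw (\<lambda>g. h \<otimes> g) (carrier G) (carrier G)"
  by (rule bij_betw_byWitness[where f' = "\<lambda>g. inv h \<otimes> g"])
    (use assms in \<open>auto simp: m_assoc[symmetric]\<close>)

text \<open>Averaging turns an arbitrary matrix into an intertwiner: multiplying by \<open>\<rho>(h)\<close> on the left and by
  \<open>\<sigma>(h\<inverse>)\<close> on the right only permutes the summands.\<close>

lemma averaged_intertwines: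
  assumes rho: "representation G n \<rho>" and sig: "representation G m \<sigma>"
    and A: "A \<in> carrier_mat n m"
  shows "intertwines G \<rho> \<sigma> (mat_sum n m (\<lambda>g. \<rho> g * A * \<sigma> (inv g)) (carrier G))"
  unfolding intertwines_def
proof
  fix h assume h: "h \<in> carrier G"
  note cr = representationD(1)[OF rho] and cs = representationD(1)[OF sig]
  let ?f = "\<lambda>g. \<rho> g * A * \<sigma> (inv g)"
  have f: "?f g \<in> carrier_mat n m" if "g \<in> carrier G" for g
    using cr[OF that] cs[of "inv g"] A that by auto
  have step: "\<rho> h * ?f g = ?f (h \<otimes> g) * \<sigma> h" if g: "g \<in> carrier G" for g
  proof -
    have gh: "inv (h \<otimes> g) \<otimes> h = inv g"
      using g h by (simp add: inv_mult_group m_assoc)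
    have c: "\<rho> h \<in> carrier_mat n n" "\<rho> g \<in> carrier_mat n n" "\<sigma> h \<in> carrier_mat m m"
        "\<sigma> (inv (h \<otimes> g)) \<in> carrier_mat m m" "\<sigma> (inv g) \<in> carrier_mat m m"
      using cr cs g h by auto
    have "?f (h \<otimes> g) * \<sigma> h = (\<rho> h * \<rho> g * A) * (\<sigma> (inv (h \<otimes> g)) * \<sigma> h)"
      unfolding representationD(2)[OF rho h g] by (rule assoc_mult_mat) (use c A in auto)
    also have "\<sigma> (inv (h \<otimes> g)) * \<sigma> h = \<sigma> (inv g)"
      using representationD(2)[OF sig, of "inv (h \<otimes> g)" h] g h gh by simp
    also have "(\<rho> h * \<rho> g * A) * \<sigma> (inv g) = \<rho> h * ?f g"
      using c A by (simp add: assoc_mult_mat[of _ n n _ n _ m] assoc_mult_mat[of _ n n _ m _ m]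
          assoc_mult_mat[of _ n m _ m _ m])
    finally show ?thesis by simp
  qed
  have "\<rho> h * mat_sum n m ?f (carrier G) = mat_sum n m (\<lambda>g. ?f (h \<otimes> g) * \<sigma> h) (carrier G)"
    using mult_mat_sum[OF cr[OF h], of "carrier G" ?f] f
    by (simp add: step cong: mat_sum_cong)
  also have "\<dots> = mat_sum n m (\<lambda>g. ?f (h \<otimes> g)) (carrier G) * \<sigma> h"
    by (rule mat_sum_mult[symmetric]) (use f cs h in auto)
  also have "mat_sum n m (\<lambda>g. ?f (h \<otimes> g)) (carrier G) = mat_sum n m ?f (carrier G)"
    using mat_sum_reindex[OF bij_betw_left_mult[OF h], of n m ?f] by simp
  finally show "\<rho> h * mat_sum n m ?f (carrier G) = mat_sum n m ?f (carrier G) * \<sigma> h" .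
qed

text \<open>Averaging the matrix unit \<open>E\<^sub>i\<^sub>k\<close> gives an intertwiner \<open>T\<^sub>i\<^sub>k\<close> whose \<open>(i,k)\<close> entry is the sum of
  \<open>\<rho>(g)\<^sub>i\<^sub>i \<sigma>(g\<inverse>)\<^sub>k\<^sub>k\<close> over \<open>g\<close>, so the inner product is the sum of these entries. If the characters differ,
  all \<open>T\<^sub>i\<^sub>k\<close> vanish by Schur's lemma. If they agree, one may take \<open>\<sigma> = \<rho>\<close>; then \<open>T\<^sub>i\<^sub>k\<close> is scalar, so that
  its \<open>(i,k)\<close> entry is \<open>0\<close> for \<open>i \<noteq> k\<close>, while for \<open>i = k\<close> its trace \<open>|G|\<close> determines the scalar.\<close>

lemma irreducible_character_orthogonality:
  assumes irr: "irreducible_representation G n \<rho>" "irreducible_representation G m \<sigma>"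
  shows "(\<Sum>g\<in>carrier G. character G \<rho> g * character G \<sigma> (inv g)) =
    (if character G \<rho> = character G \<sigma> then of_nat (card (carrier G)) else 0)"
proof -
  define E where "E p q k = mat p q (\<lambda>ij. if ij = k then 1 else (0::complex))" for p q k
  define T where
    "T n \<rho> m \<sigma> k = mat_sum n m (\<lambda>g. \<rho> g * E n m k * \<sigma> (inv g)) (carrier G)"
    for n m k and \<rho> \<sigma> :: "'a \<Rightarrow> complex mat"
  have E: "E p q k \<in> carrier_mat p q" for p q k unfolding E_def by simp
  have T: "T n \<rho> m \<sigma> k \<in> carrier_mat n m" for n m k and \<rho> \<sigma> :: "'a \<Rightarrow> complex mat"
    unfolding T_def by simp
  have inner: "(\<Sum>g\<in>carrier G. character G \<rho> g * character G \<sigma> (inv g)) =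
      (\<Sum>i<n. \<Sum>k<m. T n \<rho> m \<sigma> (i, k) $$ (i, k))"
    if "representation G n \<rho>" "representation G m \<sigma>" for n m \<rho> \<sigma>
  proof -
    note c = representationD(1)[OF that(1)] representationD(1)[OF that(2)]
    have "(\<Sum>i<n. \<Sum>k<m. T n \<rho> m \<sigma> (i, k) $$ (i, k)) =
        (\<Sum>i<n. \<Sum>k<m. \<Sum>g\<in>carrier G. \<rho> g $$ (i, i) * \<sigma> (inv g) $$ (k, k))"
      using c by (intro sum.cong) (auto simp: T_def E_def mult_mat_unit_entry)
    also have "\<dots> = (\<Sum>g\<in>carrier G. (\<Sum>i<n. \<rho> g $$ (i, i)) * (\<Sum>k<m. \<sigma> (inv g) $$ (k, k)))"
      by (simp add: sum.swap[of _ "carrier G"] sum_product)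
    also have "\<dots> = (\<Sum>g\<in>carrier G. character G \<rho> g * character G \<sigma> (inv g))"
      using c by (intro sum.cong) (auto simp: character_eq_tr tr_eq_sum[of _ n] tr_eq_sum[of _ m])
    finally show ?thesis by simp
  qed
  have rep: "representation G n \<rho>" "representation G m \<sigma>" and n: "0 < n"
    using irr unfolding irreducible_representation_def by auto
  show ?thesis
  proof (cases "character G \<rho> = character G \<sigma>")
    case False
    have "T n \<rho> m \<sigma> k = 0\<^sub>m n m" for k
      using nonzero_intertwiner_imp_character_eq[OF irr T] False
        averaged_intertwines[OF rep E] unfolding T_def by blast
    then show ?thesis using False by (simp add: inner[OF rep])
  next
    case True
    note c = representationD(1)[OF rep(1)]
    have val: "T n \<rho> n \<rho> (i, k) $$ (i, k) =
        (if i = k then of_nat (card (carrier G)) / of_nat n else 0)" if ik: "i < n" "k < n" for i k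
    proof -
      obtain l where l: "T n \<rho> n \<rho> (i, k) = l \<cdot>\<^sub>m 1\<^sub>m n"
        using self_intertwiner_scalar[OF irr(1) T] averaged_intertwines[OF rep(1,1) E] unfolding T_def by blast
      show ?thesis
      proof (cases "i = k")
        case True
        have "tr (\<rho> g * E n n (i, i) * \<rho> (inv g)) = 1" if g: "g \<in> carrier G" for g
        proof -
          have cg: "\<rho> g \<in> carrier_mat n n" "\<rho> (inv g) \<in> carrier_mat n n" using c g by auto
          have "tr (\<rho> g * E n n (i, i) * \<rho> (inv g)) = tr (\<rho> (inv g) * (\<rho> g * E n n (i, i)))"
            by (rule tr_comm) (use cg E in auto)
          also have "\<rho> (inv g) * (\<rho> g * E n n (i, i)) = (\<rho> (inv g) * \<rho> g) * E n n (i, i)"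
            by (rule assoc_mult_mat[symmetric, OF cg(2,1) E])
          also have "\<rho> (inv g) * \<rho> g = 1\<^sub>m n"
            using representationD(2)[OF rep(1), of "inv g" g] g representationD(3)[OF rep(1)] by simp
          also have "1\<^sub>m n * E n n (i, i) = E n n (i, i)" using E by (rule left_mult_one_mat)
          also have "tr (E n n (i, i)) = (\<Sum>j<n. if j = i then 1 else 0)"
            unfolding tr_eq_sum[OF E] by (intro sum.cong) (auto simp: E_def)
          also have "\<dots> = 1" using ik by simp
          finally show ?thesis .
        qed
        then have "tr (T n \<rho> n \<rho> (i, k)) = of_nat (card (carrier G))"
          unfolding T_def using c E True
          by (subst tr_mat_sum) (auto intro!: mult_carrier_mat[of _ n n])
        moreover have "tr (l \<cdot>\<^sub>m 1\<^sub>m n) = l * of_nat n"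
          by (simp add: tr_smult[of _ n] tr_one)
        ultimately show ?thesis using l n ik True by (simp add: field_simps)
      next
        case False
        then show ?thesis using l ik by simp
      qed
    qed
    have "(\<Sum>g\<in>carrier G. character G \<rho> g * character G \<sigma> (inv g)) =
        (\<Sum>i<n. \<Sum>k<n. T n \<rho> n \<rho> (i, k) $$ (i, k))"
      unfolding True[symmetric] by (rule inner[OF rep(1,1)])
    also have "\<dots> = (\<Sum>i<n. \<Sum>k<n. if k = i then of_nat (card (carrier G)) / of_nat n else 0)"
      by (intro sum.cong refl) (auto simp: val)
    also have "\<dots> = of_nat (card (carrier G))" using n by simp
    finally show ?thesis using True by simp
  qed
qed

lemma IrrE:
  assumes "\<chi> \<in> Irr G"
  obtains n \<rho> where "irreducible_representation G n \<rho>" "representation G n \<rho>" "0 < n"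
    "\<chi> = character G \<rho>"
  using assms unfolding Irr_def irreducible_representation_def by auto

lemma Irr_orthogonality:
  assumes "\<chi> \<in> Irr G" "\<psi> \<in> Irr G"
  shows "(\<Sum>g\<in>carrier G. \<chi> g * \<psi> (inv g)) = (if \<chi> = \<psi> then of_nat (card (carrier G)) else 0)"
  using assms irreducible_character_orthogonality by (auto elim!: IrrE)

lemma Irr_degree:
  assumes "\<chi> \<in> Irr G"
  shows "\<exists>n>0. \<chi> \<one> = of_nat n"
proof -
  obtain n \<rho> where "representation G n \<rho>" "0 < n" "\<chi> = character G \<rho>"
    using assms by (rule IrrE)
  then show ?thesis
    using representationD(3)[of n \<rho>] by (auto simp: character_eq_tr tr_one)
qed

lemma Irr_conj:
  assumes "\<chi> \<in> Irr G" and g: "g \<in> carrier G" and x: "x \<in> carrier G"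
  shows "\<chi> (g \<otimes> x \<otimes> inv g) = \<chi> x"
proof -
  obtain n \<rho> where rep: "representation G n \<rho>" and chi: "\<chi> = character G \<rho>"
    using assms(1) by (rule IrrE)
  note c = representationD(1)[OF rep] and m = representationD(2)[OF rep, symmetric]
  have "tr (\<rho> (g \<otimes> x \<otimes> inv g)) = tr (\<rho> (g \<otimes> x) * \<rho> (inv g))"
    using g x by (simp add: m)
  also have "\<dots> = tr (\<rho> (inv g) * \<rho> (g \<otimes> x))"
    by (rule tr_comm[where n = n and m = n]) (use c g x in auto)
  also have "\<dots> = tr (\<rho> x)"
    using g x by (simp add: m m_assoc[symmetric])
  finally show ?thesis unfolding chi using g x by (simp add: character_eq_tr)
qed

text \<open>The sum \<open>E\<close> of the matrices \<open>\<rho>(h)\<close> over the normal subgroup \<open>H\<close> commutes with \<open>\<rho>\<close>, so it is scalar. If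
  \<open>E = 0\<close>, the traces of \<open>E \<rho>(g)\<close> vanish. Otherwise \<open>\<rho>(h) E = E\<close> shows \<open>\<rho>(h) = 1\<close> for all \<open>h \<in> H\<close>.\<close>

lemma Irr_normal_subgroup_dichotomy:
  assumes chi: "\<chi> \<in> Irr G" and H: "H \<lhd> G"
  shows "(\<forall>h\<in>H. \<forall>g\<in>carrier G. \<chi> (h \<otimes> g) = \<chi> g) \<or> (\<forall>g\<in>carrier G. (\<Sum>h\<in>H. \<chi> (h \<otimes> g)) = 0)"
proof -
  obtain n \<rho> where irr: "irreducible_representation G n \<rho>" and rep: "representation G n \<rho>"
    and chi: "\<chi> = character G \<rho>"
    using chi by (rule IrrE)
  note c = representationD(1)[OF rep] and m = representationD(2)[OF rep]
  interpret H: normal H G by (rule H)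
  have HG: "h \<in> carrier G" if "h \<in> H" for h using that H.subset by auto
  let ?E = "mat_sum n n \<rho> H"
  have "intertwines G \<rho> \<rho> ?E"
    unfolding intertwines_def
  proof
    fix g assume g: "g \<in> carrier G"
    have bij: "bij_betw (\<lambda>h. g \<otimes> h \<otimes> inv g) H H"
    proof (rule bij_betw_byWitness[where f' = "\<lambda>h. inv g \<otimes> h \<otimes> g"])
      show "\<forall>h\<in>H. inv g \<otimes> (g \<otimes> h \<otimes> inv g) \<otimes> g = h"
        using g HG by (simp add: m_assoc) (simp add: m_assoc[symmetric])
      show "\<forall>h\<in>H. g \<otimes> (inv g \<otimes> h \<otimes> g) \<otimes> inv g = h"
        using g HG by (simp add: m_assoc) (simp add: m_assoc[symmetric])
      show "(\<lambda>h. g \<otimes> h \<otimes> inv g) ` H \<subseteq> H" using H.inv_op_closed2[OF g] by auto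
      show "(\<lambda>h. inv g \<otimes> h \<otimes> g) ` H \<subseteq> H" using H.inv_op_closed1[OF g] by auto
    qed
    have "\<rho> g * ?E = mat_sum n n (\<lambda>h. \<rho> g * \<rho> h) H"
      by (rule mult_mat_sum) (use c g HG in auto)
    also have "\<dots> = mat_sum n n (\<lambda>h. \<rho> (g \<otimes> h \<otimes> inv g) * \<rho> g) H"
    proof (rule mat_sum_cong)
      fix h assume "h \<in> H"
      then show "\<rho> g * \<rho> h = \<rho> (g \<otimes> h \<otimes> inv g) * \<rho> g"
        using g HG m[of g h] m[of "g \<otimes> h \<otimes> inv g" g] by (simp add: m_assoc)
    qed
    also have "\<dots> = mat_sum n n (\<lambda>h. \<rho> (g \<otimes> h \<otimes> inv g)) H * \<rho> g"
      by (rule mat_sum_mult[symmetric]) (use c g HG in auto)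
    also have "mat_sum n n (\<lambda>h. \<rho> (g \<otimes> h \<otimes> inv g)) H = ?E"
      using mat_sum_reindex[OF bij, of n n \<rho>] by simp
    finally show "\<rho> g * ?E = ?E * \<rho> g" .
  qed
  then obtain l where l: "?E = l \<cdot>\<^sub>m 1\<^sub>m n"
    using self_intertwiner_scalar[OF irr mat_sum_carrier] by blast
  show ?thesis
  proof (cases "l = 0")
    case True
    have "(\<Sum>h\<in>H. \<chi> (h \<otimes> g)) = 0" if g: "g \<in> carrier G" for g
    proof -
      have "(\<Sum>h\<in>H. \<chi> (h \<otimes> g)) = (\<Sum>h\<in>H. tr (\<rho> h * \<rho> g))"
        using g HG by (intro sum.cong) (auto simp: chi character_eq_tr m)
      also have "\<dots> = tr (mat_sum n n (\<lambda>h. \<rho> h * \<rho> g) H)"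
        by (rule tr_mat_sum[symmetric]) (use c g HG in \<open>auto intro!: mult_carrier_mat[of _ n n]\<close>)
      also have "mat_sum n n (\<lambda>h. \<rho> h * \<rho> g) H = ?E * \<rho> g"
        by (rule mat_sum_mult[symmetric]) (use c g HG in auto)
      also have "?E * \<rho> g = l \<cdot>\<^sub>m \<rho> g"
        using c[OF g] by (simp add: l mult_smult_assoc_mat[OF one_carrier_mat c[OF g]])
      also have "tr (l \<cdot>\<^sub>m \<rho> g) = 0" using True by (simp add: tr_smult[OF c[OF g]])
      finally show ?thesis .
    qed
    then show ?thesis by blast
  next
    case False
    have "\<rho> h = 1\<^sub>m n" if h: "h \<in> H" for h
    proof -
      have bij: "bij_betw (\<lambda>k. h \<otimes> k) H H"
        by (rule bij_betw_byWitness[where f' = "\<lambda>k. inv h \<otimes> k"])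
          (use h HG in \<open>auto simp: m_assoc[symmetric]\<close>)
      have "\<rho> h * ?E = mat_sum n n (\<lambda>k. \<rho> h * \<rho> k) H"
        by (rule mult_mat_sum) (use c h HG in auto)
      also have "\<dots> = mat_sum n n (\<lambda>k. \<rho> (h \<otimes> k)) H"
        by (rule mat_sum_cong) (use m h HG in auto)
      also have "\<dots> = ?E" using mat_sum_reindex[OF bij, of n n \<rho>] by simp
      also have "\<rho> h * ?E = l \<cdot>\<^sub>m \<rho> h"
        using c[OF HG[OF h]] by (simp add: l mult_smult_distrib[OF c[OF HG[OF h]] one_carrier_mat])
      finally have eq: "l \<cdot>\<^sub>m \<rho> h = l \<cdot>\<^sub>m 1\<^sub>m n" using l by simp
      show ?thesis
      proof (rule eq_matI)
        fix i j assume "i < dim_row (1\<^sub>m n :: complex mat)" "j < dim_col (1\<^sub>m n :: complex mat)"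
        then show "\<rho> h $$ (i, j) = 1\<^sub>m n $$ (i, j)"
          using arg_cong[OF eq, of "\<lambda>A. A $$ (i, j)"] c[OF HG[OF h]] False by simp
      qed (use c[OF HG[OF h]] in auto)
    qed
    then have "\<chi> (h \<otimes> g) = \<chi> g" if "h \<in> H" "g \<in> carrier G" for h g
      using that HG m[of h g] c[of g] by (simp add: chi character_eq_tr)
    then show ?thesis by blast
  qed
qed

end

text \<open>A right inverse of a square matrix is also a left inverse. Padding with zeros shows at the same
  time that the matrices are square: a zero row of the second one would survive in the reversed product.
  The first part bounds the number of irreducible characters; the second turns the
  orthogonality of the \<open>S\<close>-characters into an expansion of indicator functions.\<close>

lemma biorthogonal_square:
  fixes a :: "'i \<Rightarrow> 'j \<Rightarrow> 'k::field" and b :: "'j \<Rightarrow> 'i \<Rightarrow> 'k"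
  assumes I: "finite I" and J: "finite J" and card: "card J \<le> card I"
    and ab: "\<And>i i'. i \<in> I \<Longrightarrow> i' \<in> I \<Longrightarrow> (\<Sum>j\<in>J. a i j * b j i') = (if i = i' then 1 else 0)"
  shows "card I = card J"
    and "j \<in> J \<Longrightarrow> j' \<in> J \<Longrightarrow> (\<Sum>i\<in>I. b j i * a i j') = (if j = j' then 1 else 0)"
proof -
  obtain f where f: "bij_betw f {..<card I} I"
    using ex_bij_betw_nat_finite[OF I] by (auto simp: atLeast0LessThan)
  obtain g where g: "bij_betw g {..<card J} J"
    using ex_bij_betw_nat_finite[OF J] by (auto simp: atLeast0LessThan)
  let ?n = "card I"
  have fI: "f r \<in> I" if "r < ?n" for r using bij_betwE[OF f] that by auto
  define A where "A = mat ?n ?n (\<lambda>(r, s). if s < card J then a (f r) (g s) else 0)"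
  define B where "B = mat ?n ?n (\<lambda>(s, r). if s < card J then b (g s) (f r) else 0)"
  have A: "A \<in> carrier_mat ?n ?n" and B: "B \<in> carrier_mat ?n ?n"
    unfolding A_def B_def by auto
  have "A * B = 1\<^sub>m ?n"
  proof (rule eq_matI)
    fix r r' assume "r < dim_row (1\<^sub>m ?n :: 'k mat)" "r' < dim_col (1\<^sub>m ?n :: 'k mat)"
    then have r: "r < ?n" "r' < ?n" by auto
    have "(A * B) $$ (r, r') = (\<Sum>s<?n. if s < card J then a (f r) (g s) * b (g s) (f r') else 0)"
      using r unfolding A_def B_def
      by (auto simp: scalar_prod_def atLeast0LessThan intro!: sum.cong)
    also have "\<dots> = (\<Sum>s<card J. a (f r) (g s) * b (g s) (f r'))"
      using card by (intro sum.mono_neutral_cong_right) auto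
    also have "\<dots> = (\<Sum>j\<in>J. a (f r) j * b j (f r'))"
      by (rule sum.reindex_bij_betw[OF g])
    also have "\<dots> = (if f r = f r' then 1 else 0)" using r by (intro ab fI)
    also have "f r = f r' \<longleftrightarrow> r = r'"
      using bij_betw_imp_inj_on[OF f] r by (auto simp: inj_on_def)
    finally show "(A * B) $$ (r, r') = 1\<^sub>m ?n $$ (r, r')" using r by simp
  qed (use A B in auto)
  then have BA: "B * A = 1\<^sub>m ?n" by (rule mat_mult_left_right_inverse[OF A B])
  have BA': "(\<Sum>r<?n. (if s < card J then b (g s) (f r) else 0) *
      (if s' < card J then a (f r) (g s') else 0)) = (if s = s' then 1 else 0)"
    if "s < ?n" "s' < ?n" for s s'
  proof -
    have "(B * A) $$ (s, s') = (\<Sum>r<?n. (if s < card J then b (g s) (f r) else 0) *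
      (if s' < card J then a (f r) (g s') else 0))"
      using that unfolding A_def B_def by (auto simp: scalar_prod_def atLeast0LessThan)
    then show ?thesis using that by (simp add: BA)
  qed
  show eq: "card I = card J"
  proof (rule ccontr)
    assume "card I \<noteq> card J"
    then have "card J < ?n" using card by simp
    then show False using BA'[of "card J" "card J"] by simp
  qed
  assume j: "j \<in> J" "j' \<in> J"
  obtain s s' where s: "s < card J" "s' < card J" "j = g s" "j' = g s'"
    using j bij_betw_imp_surj_on[OF g] by blast
  have "(\<Sum>i\<in>I. b j i * a i j') = (\<Sum>r<?n. b j (f r) * a (f r) j')"
    by (rule sum.reindex_bij_betw[OF f, symmetric])
  also have "\<dots> = (if s = s' then 1 else 0)" using BA'[of s s'] s eq by simp
  also have "s = s' \<longleftrightarrow> j = j'"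
    using bij_betw_imp_inj_on[OF g] s by (auto simp: inj_on_def)
  finally show "(\<Sum>i\<in>I. b j i * a i j') = (if j = j' then 1 else 0)" .
qed

text \<open>By orthogonality, at most \<open>|G|\<close> irreducible characters fit into the space of functions on \<open>G\<close>.
  Finiteness is essential for \<open>\<sigma>\<^sub>X\<close>, as a sum over an infinite set is \<open>0\<close> by convention.\<close>

lemma (in group) finite_Irr:
  assumes fin: "finite (carrier G)"
  shows "finite (Irr G)"
proof (rule ccontr)
  assume "infinite (Irr G)"
  then obtain F where F: "F \<subseteq> Irr G" "finite F" "card F = Suc (card (carrier G))"
    using infinite_arbitrarily_large by blast
  have pos: "card (carrier G) > 0" using fin one_closed card_gt_0_iff by blast
  have "card F = card (carrier G)"
  proof (rule biorthogonal_square(1)[where a = "\<lambda>\<chi> g. \<chi> g" and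
        b = "\<lambda>g \<chi>. \<chi> (inv g) / of_nat (card (carrier G))"])
    fix \<chi> \<psi> assume "\<chi> \<in> F" "\<psi> \<in> F"
    then have "(\<Sum>g\<in>carrier G. \<chi> g * \<psi> (inv g)) = (if \<chi> = \<psi> then of_nat (card (carrier G)) else 0)"
      using F by (intro Irr_orthogonality) auto
    then show "(\<Sum>g\<in>carrier G. \<chi> g * (\<psi> (inv g) / of_nat (card (carrier G)))) = (if \<chi> = \<psi> then 1 else 0)"
      using pos by (simp add: sum_divide_distrib[symmetric])
  qed (use F fin in auto)
  then show False using F by simp
qed

section \<open>Superclasses and supercharacters\<close>

lemma (in group) sum_inv_subgroup:
  assumes "subgroup H G"
  shows "(\<Sum>h\<in>H. f (inv h)) = (\<Sum>h\<in>H. f h :: complex)"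
proof -
  interpret subgroup H G by (rule assms)
  have "bij_betw (\<lambda>h. inv h) H H"
    by (rule bij_betw_byWitness[where f' = "\<lambda>h. inv h"]) auto
  then show ?thesis by (rule sum.reindex_bij_betw)
qed

lemma (in group) union_of_cosets_iff:
  assumes M: "subgroup M G" and Y: "Y \<subseteq> carrier G"
  shows "union_of_cosets G M Y \<longleftrightarrow> (\<forall>m\<in>M. \<forall>y\<in>Y. m \<otimes> y \<in> Y)"
proof
  assume "union_of_cosets G M Y"
  then obtain \<C> where C: "\<C> \<subseteq> rcosets M" "Y = \<Union>\<C>" unfolding union_of_cosets_def by auto
  show "\<forall>m\<in>M. \<forall>y\<in>Y. m \<otimes> y \<in> Y"
  proof (intro ballI)
    fix m y assume m: "m \<in> M" and "y \<in> Y"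
    then obtain x where x: "x \<in> carrier G" "M #> x \<in> \<C>" "y \<in> M #> x"
      using C unfolding RCOSETS_def by auto
    then obtain k where k: "k \<in> M" "y = k \<otimes> x" unfolding r_coset_def by auto
    have "m \<otimes> y = (m \<otimes> k) \<otimes> x"
      using m k x subgroup.subset[OF M] by (auto simp: m_assoc subset_iff)
    then have "m \<otimes> y \<in> M #> x"
      using subgroup.m_closed[OF M m k(1)] unfolding r_coset_def by auto
    then show "m \<otimes> y \<in> Y" using C x by auto
  qed
next
  assume cl: "\<forall>m\<in>M. \<forall>y\<in>Y. m \<otimes> y \<in> Y"
  have "Y = (\<Union>y\<in>Y. M #> y)"
  proof
    show "Y \<subseteq> (\<Union>y\<in>Y. M #> y)" using rcos_self[OF _ M] Y by blast
    show "(\<Union>y\<in>Y. M #> y) \<subseteq> Y" using cl unfolding r_coset_def by blast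
  qed
  moreover have "(\<lambda>y. M #> y) ` Y \<subseteq> rcosets M" using Y unfolding RCOSETS_def by auto
  ultimately show "union_of_cosets G M Y" unfolding union_of_cosets_def by blast
qed

text \<open>The pair is split into its two partitions, so that they can be named separately.\<close>

locale supercharacter_theory_group = group G for G (structure) +
  fixes \<X> :: "('a \<Rightarrow> complex) set set" and \<Y> :: "'a set set"
  assumes finite_carrier: "finite (carrier G)"
    and supercharacters: "supercharacter_theory G (\<X>, \<Y>)"
begin

abbreviation "\<sigma> \<equiv> sigma_char G"

lemma partitions: "partition_on (Irr G) \<X>" "partition_on (carrier G) \<Y>"
  and one_class: "{\<one>} \<in> \<Y>" and card_eq: "card \<X> = card \<Y>"
  and sigma_const: "X \<in> \<X> \<Longrightarrow> Y \<in> \<Y> \<Longrightarrow> g \<in> Y \<Longrightarrow> h \<in> Y \<Longrightarrow> \<sigma> X g = \<sigma> X h"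
  using supercharacters unfolding supercharacter_theory_def prod.case by blast+

lemma carrier_eq: "\<Union>\<Y> = carrier G" and class_subset: "Y \<in> \<Y> \<Longrightarrow> Y \<subseteq> carrier G"
  using partition_onD1[OF partitions(2)] by blast+

lemma classes_disjoint: "Y \<in> \<Y> \<Longrightarrow> Z \<in> \<Y> \<Longrightarrow> g \<in> Y \<Longrightarrow> g \<in> Z \<Longrightarrow> Y = Z"
  using partition_onD2[OF partitions(2)] by (auto simp: disjoint_def)

lemma finite_classes: "finite \<Y>" and finite_class: "Y \<in> \<Y> \<Longrightarrow> finite Y"
  using finite_carrier carrier_eq by (auto simp: finite_UnionD intro: finite_subset[OF class_subset])

lemma sum_over_classes:
  assumes "\<C> \<subseteq> \<Y>"
  shows "(\<Sum>g\<in>\<Union>\<C>. f g) = (\<Sum>Y\<in>\<C>. \<Sum>g\<in>Y. f g :: complex)"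
proof -
  have "\<forall>A\<in>\<C>. finite A" using assms finite_class by blast
  moreover have "\<forall>A\<in>\<C>. \<forall>B\<in>\<C>. A \<noteq> B \<longrightarrow> A \<inter> B = {}" using assms classes_disjoint by blast
  ultimately show ?thesis using sum.Union_disjoint[of \<C> f] by simp
qed

lemma finite_chars: "finite \<X>" and finite_part: "X \<in> \<X> \<Longrightarrow> finite X"
  and part_subset: "X \<in> \<X> \<Longrightarrow> X \<subseteq> Irr G" and part_nonempty: "X \<in> \<X> \<Longrightarrow> X \<noteq> {}"
proof -
  have "\<Union>\<X> = Irr G" using partition_onD1[OF partitions(1)] by simp
  then show "finite \<X>" and sub: "X \<in> \<X> \<Longrightarrow> X \<subseteq> Irr G"
    using finite_Irr[OF finite_carrier] by (auto intro: finite_UnionD)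
  show "X \<in> \<X> \<Longrightarrow> finite X" using sub finite_Irr[OF finite_carrier] finite_subset by blast
  show "X \<in> \<X> \<Longrightarrow> X \<noteq> {}" using partition_onD3[OF partitions(1)] by auto
qed

lemma card_pos: "card (carrier G) > 0"
  using finite_carrier one_closed card_gt_0_iff by blast

lemma sigma_one_nonzero:
  assumes X: "X \<in> \<X>"
  shows "\<sigma> X \<one> \<noteq> 0"
proof -
  have "\<forall>\<chi>\<in>X. \<exists>n>0. \<chi> \<one> = of_nat n" using part_subset[OF X] Irr_degree by blast
  then obtain d where d: "\<And>\<chi>. \<chi> \<in> X \<Longrightarrow> d \<chi> > 0 \<and> \<chi> \<one> = of_nat (d \<chi>)" by metis
  have "\<sigma> X \<one> = of_nat (\<Sum>\<chi>\<in>X. d \<chi> * d \<chi>)"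
    unfolding sigma_char_def using d by (simp add: of_nat_sum)
  moreover have "(\<Sum>\<chi>\<in>X. d \<chi> * d \<chi>) > 0"
    using finite_part[OF X] part_nonempty[OF X] d by (intro sum_pos) auto
  ultimately show ?thesis by (metis of_nat_eq_0_iff less_irrefl)
qed

lemma sigma_Irr_inner:
  assumes X: "X \<in> \<X>" and psi: "\<psi> \<in> Irr G"
  shows "(\<Sum>g\<in>carrier G. \<sigma> X g * \<psi> (inv g)) =
    (if \<psi> \<in> X then of_nat (card (carrier G)) * \<psi> \<one> else 0)"
proof -
  have "(\<Sum>g\<in>carrier G. \<sigma> X g * \<psi> (inv g)) =
      (\<Sum>g\<in>carrier G. \<Sum>\<chi>\<in>X. \<chi> \<one> * (\<chi> g * \<psi> (inv g)))"
    unfolding sigma_char_def by (simp add: sum_distrib_right mult.assoc)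
  also have "\<dots> = (\<Sum>\<chi>\<in>X. \<chi> \<one> * (\<Sum>g\<in>carrier G. \<chi> g * \<psi> (inv g)))"
    by (subst sum.swap) (simp add: sum_distrib_left)
  also have "\<dots> = (\<Sum>\<chi>\<in>X. if \<chi> = \<psi> then of_nat (card (carrier G)) * \<psi> \<one> else 0)"
    using part_subset[OF X] psi by (intro sum.cong refl) (auto simp: Irr_orthogonality)
  finally show ?thesis using finite_part[OF X] by simp
qed

lemma sigma_inner:
  assumes X: "X \<in> \<X>" and X': "X' \<in> \<X>"
  shows "(\<Sum>g\<in>carrier G. \<sigma> X g * \<sigma> X' (inv g)) =
    (if X = X' then of_nat (card (carrier G)) * \<sigma> X \<one> else 0)"
proof -
  have "(\<Sum>g\<in>carrier G. \<sigma> X g * \<sigma> X' (inv g)) =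
      (\<Sum>g\<in>carrier G. \<Sum>\<psi>\<in>X'. \<psi> \<one> * (\<sigma> X g * \<psi> (inv g)))"
    unfolding sigma_char_def[of G X'] by (simp add: sum_distrib_left mult_ac)
  also have "\<dots> = (\<Sum>\<psi>\<in>X'. \<psi> \<one> * (\<Sum>g\<in>carrier G. \<sigma> X g * \<psi> (inv g)))"
    by (subst sum.swap) (simp add: sum_distrib_left)
  also have "\<dots> = (\<Sum>\<psi>\<in>X'. \<psi> \<one> * (if \<psi> \<in> X then of_nat (card (carrier G)) * \<psi> \<one> else 0))"
    using part_subset[OF X'] by (intro sum.cong refl) (auto simp: sigma_Irr_inner[OF X])
  also have "\<dots> = (if X = X' then of_nat (card (carrier G)) * \<sigma> X \<one> else 0)"
  proof (cases "X = X'")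
    case True
    then show ?thesis by (simp add: sigma_char_def sum_distrib_left mult_ac)
  next
    case False
    then have "X \<inter> X' = {}"
      using partition_onD2[OF partitions(1)] X X' by (auto simp: disjoint_def)
    then show ?thesis using False by (intro trans[OF sum.neutral]) auto
  qed
  finally show ?thesis .
qed

text \<open>The Fourier coefficient of the indicator function of \<open>A\<close> with respect to the orthogonal family
  of \<open>S\<close>-characters: by \<open>sigma_inner\<close>, the inner product of \<open>\<sigma>\<^sub>X\<close> with itself
  is \<open>|G| \<sigma>\<^sub>X(1)\<close>.\<close>

definition indicator_coeff :: "'a set \<Rightarrow> ('a \<Rightarrow> complex) set \<Rightarrow> complex" where
  "indicator_coeff A X = (\<Sum>g\<in>A. \<sigma> X (inv g)) / (of_nat (card (carrier G)) * \<sigma> X \<one>)"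

text \<open>Orthogonality says that the table of values of the \<open>S\<close>-characters on the \<open>S\<close>-classes has the
  table of coefficients as a right inverse. As \<open>|\<X>| = |\<Y>|\<close>, it is also a left inverse, which
  is the claimed expansion.\<close>

lemma class_indicator_expansion:
  assumes Y: "Y \<in> \<Y>" and z: "z \<in> carrier G"
  shows "(\<Sum>X\<in>\<X>. indicator_coeff Y X * \<sigma> X z) = (if z \<in> Y then 1 else 0)"
proof -
  obtain Z where Z: "Z \<in> \<Y>" "z \<in> Z" using z carrier_eq by auto
  define rep where "rep W = (SOME g. g \<in> W)" for W :: "'a set"
  have rep: "rep W \<in> W" if "W \<in> \<Y>" for W
    unfolding rep_def using partition_onD3[OF partitions(2)] that by (metis some_in_eq)
  have orth: "(\<Sum>W\<in>\<Y>. \<sigma> X (rep W) * indicator_coeff W X') = (if X = X' then 1 else 0)"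
    if X: "X \<in> \<X>" "X' \<in> \<X>" for X X'
  proof -
    let ?c = "of_nat (card (carrier G)) * \<sigma> X' \<one>"
    have "(\<Sum>W\<in>\<Y>. \<sigma> X (rep W) * indicator_coeff W X') =
        (\<Sum>W\<in>\<Y>. (\<Sum>g\<in>W. \<sigma> X g * \<sigma> X' (inv g)) / ?c)"
    proof (intro sum.cong refl)
      fix W assume W: "W \<in> \<Y>"
      have "(\<Sum>g\<in>W. \<sigma> X g * \<sigma> X' (inv g)) = (\<Sum>g\<in>W. \<sigma> X (rep W) * \<sigma> X' (inv g))"
        using sigma_const[OF X(1) W _ rep[OF W]] by (intro sum.cong) auto
      then show "\<sigma> X (rep W) * indicator_coeff W X' = (\<Sum>g\<in>W. \<sigma> X g * \<sigma> X' (inv g)) / ?c"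
        by (simp add: indicator_coeff_def sum_distrib_left)
    qed
    also have "\<dots> = (\<Sum>W\<in>\<Y>. \<Sum>g\<in>W. \<sigma> X g * \<sigma> X' (inv g)) / ?c"
      by (rule sum_divide_distrib[symmetric])
    also have "(\<Sum>W\<in>\<Y>. \<Sum>g\<in>W. \<sigma> X g * \<sigma> X' (inv g)) =
        (\<Sum>g\<in>carrier G. \<sigma> X g * \<sigma> X' (inv g))"
      by (simp only: carrier_eq[symmetric] sum_over_classes[OF subset_refl])
    finally show ?thesis
      using sigma_one_nonzero[OF X(1)] card_pos by (auto simp: sigma_inner[OF X])
  qed
  have dual: "(\<Sum>X\<in>\<X>. indicator_coeff Y X * \<sigma> X (rep Z)) = (if Y = Z then 1 else 0)"
    using biorthogonal_square(2)[OF finite_chars finite_classes _ orth Y Z(1)] card_eq by simp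
  have same: "Y = Z \<longleftrightarrow> z \<in> Y" using classes_disjoint[OF Y Z(1) _ Z(2)] Z(2) by blast
  have "(\<Sum>X\<in>\<X>. indicator_coeff Y X * \<sigma> X z) = (\<Sum>X\<in>\<X>. indicator_coeff Y X * \<sigma> X (rep Z))"
    by (intro sum.cong refl arg_cong2[where f = "(*)"] sigma_const[OF _ Z rep[OF Z(1)]])
  also have "\<dots> = (if z \<in> Y then 1 else 0)"
    unfolding dual same ..
  finally show ?thesis .
qed

text \<open>The indicator function of \<open>Y\<close> is a combination of \<open>S\<close>-characters, so it takes the same value at
  \<open>g\<close> and \<open>h\<close>.\<close>

lemma sigma_separates_classes:
  assumes "Y \<in> \<Y>" "g \<in> Y" "h \<in> carrier G" and eq: "\<And>X. X \<in> \<X> \<Longrightarrow> \<sigma> X h = \<sigma> X g"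
  shows "h \<in> Y"
proof -
  have "(\<Sum>X\<in>\<X>. indicator_coeff Y X * \<sigma> X h) = (\<Sum>X\<in>\<X>. indicator_coeff Y X * \<sigma> X g)"
    by (intro sum.cong) (auto simp: eq)
  moreover have "g \<in> carrier G" using assms class_subset by blast
  ultimately show ?thesis
    using assms(2) class_indicator_expansion[OF assms(1,3)] class_indicator_expansion[OF assms(1), of g]
    by (auto split: if_splits)
qed

lemma S_normalD:
  assumes "S_normal G (\<X>, \<Y>) H"
  shows "subgroup H G" and "H \<subseteq> carrier G" and "finite H"
    and "Y \<in> \<Y> \<Longrightarrow> g \<in> Y \<Longrightarrow> g \<in> H \<Longrightarrow> Y \<subseteq> H"
proof -
  obtain \<C> where C: "subgroup H G" "\<C> \<subseteq> \<Y>" "H = \<Union>\<C>"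
    using assms unfolding S_normal_def S_classes_def by auto
  then show "subgroup H G" "H \<subseteq> carrier G" by (auto dest: subgroup.subset)
  then show "finite H" using finite_carrier finite_subset by blast
  show "Y \<in> \<Y> \<Longrightarrow> g \<in> Y \<Longrightarrow> g \<in> H \<Longrightarrow> Y \<subseteq> H"
    using C classes_disjoint by blast
qed

text \<open>Characters do not distinguish conjugate elements, so by separation every \<open>S\<close>-class is closed
  under conjugation.\<close>

lemma S_normal_imp_normal:
  assumes H: "S_normal G (\<X>, \<Y>) H"
  shows "H \<lhd> G"
proof (rule normal_invI)
  show "subgroup H G" using S_normalD(1)[OF H] .
  fix x h assume x: "x \<in> carrier G" and h: "h \<in> H"
  have hG: "h \<in> carrier G" using h S_normalD(2)[OF H] by auto
  obtain Y where Y: "Y \<in> \<Y>" "h \<in> Y" using hG carrier_eq by auto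
  have "x \<otimes> h \<otimes> inv x \<in> Y"
  proof (rule sigma_separates_classes[OF Y])
    fix X assume "X \<in> \<X>"
    then have "\<psi> \<in> Irr G" if "\<psi> \<in> X" for \<psi> using that part_subset by blast
    then show "\<sigma> X (x \<otimes> h \<otimes> inv x) = \<sigma> X h"
      unfolding sigma_char_def using x hG by (intro sum.cong) (simp_all add: Irr_conj)
  qed (use x hG in auto)
  then show "x \<otimes> h \<otimes> inv x \<in> H" using S_normalD(4)[OF H Y h] by auto
qed

lemma indicator_expansion:
  assumes H: "S_normal G (\<X>, \<Y>) H" and z: "z \<in> carrier G"
  shows "(\<Sum>X\<in>\<X>. indicator_coeff H X * \<sigma> X z) = (if z \<in> H then 1 else 0)"
proof -
  obtain \<C> where C: "\<C> \<subseteq> \<Y>" "H = \<Union>\<C>"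
    using H unfolding S_normal_def S_classes_def by auto
  have fin: "finite \<C>" using C finite_classes finite_subset by blast
  have "indicator_coeff H X = (\<Sum>Y\<in>\<C>. indicator_coeff Y X)" for X
    unfolding indicator_coeff_def C(2) sum_over_classes[OF C(1)] by (rule sum_divide_distrib)
  then have "(\<Sum>X\<in>\<X>. indicator_coeff H X * \<sigma> X z) = (\<Sum>Y\<in>\<C>. \<Sum>X\<in>\<X>. indicator_coeff Y X * \<sigma> X z)"
    by (simp add: sum_distrib_right) (rule sum.swap)
  also have "\<dots> = (\<Sum>Y\<in>\<C>. if z \<in> Y then 1 else 0)"
    using C z by (intro sum.cong refl class_indicator_expansion) auto
  also have "\<dots> = (if z \<in> H then 1 else 0)"
  proof (cases "z \<in> H")
    case True
    then obtain Z where Z: "Z \<in> \<C>" "z \<in> Z" using C by auto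
    have "z \<in> Y \<longleftrightarrow> Y = Z" if "Y \<in> \<C>" for Y
      using Z C(1) that classes_disjoint by blast
    then have "(\<Sum>Y\<in>\<C>. if z \<in> Y then 1 else (0::complex)) = (\<Sum>Y\<in>\<C>. if Y = Z then 1 else 0)"
      by (simp cong: sum.cong)
    then show ?thesis using Z True fin by simp
  next
    case False
    then show ?thesis using C by (intro trans[OF sum.neutral]) auto
  qed
  finally show ?thesis .
qed

text \<open>The sum of \<open>\<psi>\<close> over \<open>H\<close> is the inner product of \<open>\<psi>\<close> with the indicator function of \<open>H\<close>. In the
  expansion of that function, only the term of the part \<open>X\<close> that contains \<open>\<psi>\<close> survives. Thus the ratio of the sum over
  \<open>H\<close> to the degree depends on \<open>X\<close> alone.\<close>

lemma S_normal_character_sum_ratio: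
  assumes H: "S_normal G (\<X>, \<Y>) H" and X: "X \<in> \<X>" and psi: "\<psi> \<in> X"
  shows "(\<Sum>h\<in>H. \<psi> h) * \<sigma> X \<one> = \<psi> \<one> * (\<Sum>h\<in>H. \<sigma> X h)"
proof -
  have irr: "\<psi> \<in> Irr G" using psi part_subset[OF X] by auto
  have uniq: "\<psi> \<in> X' \<longleftrightarrow> X' = X" if "X' \<in> \<X>" for X'
    using partition_onD2[OF partitions(1)] that X psi by (auto simp: disjoint_def)
  have "(\<Sum>h\<in>H. \<psi> h) = (\<Sum>h\<in>H. \<psi> (inv h))"
    using sum_inv_subgroup[OF S_normalD(1)[OF H], of \<psi>] by simp
  also have "\<dots> = (\<Sum>g\<in>carrier G. (if g \<in> H then 1 else 0) * \<psi> (inv g))"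
    using S_normalD(2)[OF H] finite_carrier by (intro sum.mono_neutral_cong_left) auto
  also have "\<dots> = (\<Sum>g\<in>carrier G. \<Sum>X'\<in>\<X>. indicator_coeff H X' * (\<sigma> X' g * \<psi> (inv g)))"
  proof (intro sum.cong refl)
    fix g assume "g \<in> carrier G"
    from indicator_expansion[OF H this, symmetric]
    show "(if g \<in> H then 1 else 0) * \<psi> (inv g) = (\<Sum>X'\<in>\<X>. indicator_coeff H X' * (\<sigma> X' g * \<psi> (inv g)))"
      by (simp only: sum_distrib_right mult.assoc)
  qed
  also have "\<dots> = (\<Sum>X'\<in>\<X>. indicator_coeff H X' * (\<Sum>g\<in>carrier G. \<sigma> X' g * \<psi> (inv g)))"
    by (subst sum.swap) (simp add: sum_distrib_left)
  also have "\<dots> = (\<Sum>X'\<in>\<X>. if X' = X then indicator_coeff H X * (of_nat (card (carrier G)) * \<psi> \<one>) else 0)"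
    by (intro sum.cong refl) (auto simp: sigma_Irr_inner[OF _ irr] uniq)
  also have "\<dots> = indicator_coeff H X * (of_nat (card (carrier G)) * \<psi> \<one>)"
    using X finite_chars by simp
  also have "\<dots> = (\<Sum>h\<in>H. \<sigma> X h) / \<sigma> X \<one> * \<psi> \<one>"
    using card_pos sum_inv_subgroup[OF S_normalD(1)[OF H], of "\<sigma> X"]
    by (simp add: indicator_coeff_def field_simps)
  finally show ?thesis using sigma_one_nonzero[OF X] by (simp add: field_simps)
qed

text \<open>By the preceding ratio, the sums over \<open>H\<close> of the members of \<open>X\<close> vanish all together or not at
  all, so that the same alternative for irreducible characters applies to all of them. The sum of
  \<open>\<sigma>\<^sub>X\<close> over \<open>H\<close> decides which one: it is nonzero exactly if \<open>H\<close> lies in the kernel of \<open>\<sigma>\<^sub>X\<close>.\<close>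

lemma sigma_S_normal_dichotomy:
  assumes H: "S_normal G (\<X>, \<Y>) H" and X: "X \<in> \<X>" and g: "g \<in> carrier G"
  shows "H \<subseteq> char_kernel G (\<sigma> X) \<Longrightarrow> h \<in> H \<Longrightarrow> \<sigma> X (h \<otimes> g) = \<sigma> X g"
    and "\<not> H \<subseteq> char_kernel G (\<sigma> X) \<Longrightarrow> (\<Sum>h\<in>H. \<sigma> X (h \<otimes> g)) = 0"
proof -
  note sub = S_normalD(1)[OF H] and HG = S_normalD(2)[OF H] and fin = S_normalD(3)[OF H]
  have cardH: "card H > 0" using fin subgroup.one_closed[OF sub] card_gt_0_iff by blast
  let ?s = "\<Sum>h\<in>H. \<sigma> X h"
  have psi: "\<psi> \<in> Irr G" "\<psi> \<one> \<noteq> 0" if "\<psi> \<in> X" for \<psi>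
    using that part_subset[OF X] Irr_degree by fastforce+
  note dich = Irr_normal_subgroup_dichotomy[OF psi(1) S_normal_imp_normal[OF H]]
  have zero: "(\<Sum>h\<in>H. \<psi> h) = 0 \<longleftrightarrow> ?s = 0" if "\<psi> \<in> X" for \<psi>
    using S_normal_character_sum_ratio[OF H X that] psi(2)[OF that] sigma_one_nonzero[OF X] by auto
  have ker: "?s = of_nat (card H) * \<sigma> X \<one>" if "H \<subseteq> char_kernel G (\<sigma> X)"
  proof -
    have "?s = (\<Sum>h\<in>H. \<sigma> X \<one>)" using that by (intro sum.cong) (auto simp: char_kernel_def)
    then show ?thesis by simp
  qed
  have invariant: "\<sigma> X (h \<otimes> g) = \<sigma> X g" if nz: "?s \<noteq> 0" and "h \<in> H" "g \<in> carrier G" for h g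
    unfolding sigma_char_def
  proof (intro sum.cong refl)
    fix \<psi> assume p: "\<psi> \<in> X"
    have "(\<Sum>h\<in>H. \<psi> (h \<otimes> \<one>)) = (\<Sum>h\<in>H. \<psi> h)" using HG by (intro sum.cong) auto
    then have "(\<Sum>h\<in>H. \<psi> (h \<otimes> \<one>)) \<noteq> 0" using zero[OF p] nz by simp
    then show "\<psi> \<one> * \<psi> (h \<otimes> g) = \<psi> \<one> * \<psi> g" using dich[OF p] that one_closed by auto
  qed
  show "\<sigma> X (h \<otimes> g) = \<sigma> X g" if "H \<subseteq> char_kernel G (\<sigma> X)" "h \<in> H"
    using invariant ker[OF that(1)] cardH sigma_one_nonzero[OF X] that(2) g by simp
  show "(\<Sum>h\<in>H. \<sigma> X (h \<otimes> g)) = 0" if not: "\<not> H \<subseteq> char_kernel G (\<sigma> X)"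
  proof -
    have s0: "?s = 0"
    proof (rule ccontr)
      assume "?s \<noteq> 0"
      then have "\<sigma> X h = \<sigma> X \<one>" if "h \<in> H" for h
        using invariant[of h \<one>] that HG by auto
      then show False using not HG by (auto simp: char_kernel_def)
    qed
    have "(\<Sum>h\<in>H. \<psi> (h \<otimes> g)) = 0" if p: "\<psi> \<in> X" for \<psi>
    proof -
      have "\<not> (\<forall>h\<in>H. \<forall>g\<in>carrier G. \<psi> (h \<otimes> g) = \<psi> g)"
      proof
        assume inv: "\<forall>h\<in>H. \<forall>g\<in>carrier G. \<psi> (h \<otimes> g) = \<psi> g"
        have "\<psi> h = \<psi> \<one>" if "h \<in> H" for h using inv that HG r_one[of h] one_closed by (metis subsetD)
        then have "(\<Sum>h\<in>H. \<psi> h) = of_nat (card H) * \<psi> \<one>" by simp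
        then show False using zero[OF p] s0 cardH psi(2)[OF p] by simp
      qed
      then show ?thesis using dich[OF p] g by blast
    qed
    then show ?thesis
      unfolding sigma_char_def by (subst sum.swap) (simp add: sum_distrib_left[symmetric])
  qed
qed

section \<open>The subgroups V and U\<close>

lemma V_sub_le_iff:
  assumes N: "subgroup N G"
  shows "V_sub G (\<X>, \<Y>) K \<subseteq> N \<longleftrightarrow>
    (\<forall>X\<in>\<X>. \<forall>g\<in>carrier G. \<not> K \<subseteq> char_kernel G (\<sigma> X) \<longrightarrow> \<sigma> X g \<noteq> 0 \<longrightarrow> g \<in> N)"
proof -
  let ?A = "{g \<in> carrier G. \<exists>\<chi>\<in>S_characters_over G (\<X>, \<Y>) K. \<chi> g \<noteq> 0}"
  have "V_sub G (\<X>, \<Y>) K \<subseteq> N \<longleftrightarrow> ?A \<subseteq> N"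
    unfolding V_sub_def using generate_subgroup_incl[OF _ N, of ?A] generate.incl[of _ ?A G] by blast
  then show ?thesis by (auto simp: S_characters_over_def S_characters_def)
qed

lemma trivial_S_normal: "S_normal G (\<X>, \<Y>) {\<one>}"
  unfolding S_normal_def S_classes_def
  using triv_subgroup one_class by (auto intro!: exI[of _ "{{\<one>}}"])

text \<open>Suppose that every \<open>S\<close>-character without \<open>K\<close> in its kernel vanishes at some \<open>k \<noteq> 1\<close> in \<open>K\<close>. For
  the other \<open>S\<close>-characters the coefficients of the indicator functions of \<open>K\<close> and of \<open>{1}\<close> are in
  the ratio \<open>|K|\<close>. Evaluating both expansions at \<open>k\<close> gives \<open>1 = |K| \<sqdot> 0\<close>.\<close>

lemma S_normal_le_V_sub:
  assumes K: "S_normal G (\<X>, \<Y>) K"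
  shows "K \<subseteq> V_sub G (\<X>, \<Y>) K"
proof
  fix k assume k: "k \<in> K"
  have KG: "K \<subseteq> carrier G" and sub: "subgroup K G"
    using S_normalD[OF K] by auto
  have kG: "k \<in> carrier G" using k KG by auto
  let ?A = "{g \<in> carrier G. \<exists>\<chi>\<in>S_characters_over G (\<X>, \<Y>) K. \<chi> g \<noteq> 0}"
  show "k \<in> V_sub G (\<X>, \<Y>) K"
  proof (cases "k = \<one>")
    case True
    then show ?thesis unfolding V_sub_def by (simp add: generate.one)
  next
    case False
    have "\<exists>X\<in>\<X>. \<not> K \<subseteq> char_kernel G (\<sigma> X) \<and> \<sigma> X k \<noteq> 0"
    proof (rule ccontr)
      assume no: "\<not> ?thesis"
      have "indicator_coeff K X * \<sigma> X k = of_nat (card K) * (indicator_coeff {\<one>} X * \<sigma> X k)"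
        if X: "X \<in> \<X>" for X
      proof (cases "K \<subseteq> char_kernel G (\<sigma> X)")
        case True
        have "(\<Sum>g\<in>K. \<sigma> X (inv g)) = (\<Sum>g\<in>K. \<sigma> X \<one>)"
          using True subgroup.m_inv_closed[OF sub] by (intro sum.cong) (auto simp: char_kernel_def)
        then show ?thesis by (simp add: indicator_coeff_def)
      next
        case False
        then show ?thesis using no X by auto
      qed
      then have "(\<Sum>X\<in>\<X>. indicator_coeff K X * \<sigma> X k) =
          of_nat (card K) * (\<Sum>X\<in>\<X>. indicator_coeff {\<one>} X * \<sigma> X k)"
        by (simp only: sum_distrib_left cong: sum.cong)
      then show False
        using k False by (simp add: indicator_expansion[OF K kG] indicator_expansion[OF trivial_S_normal kG])
    qed
    then have "k \<in> ?A" using kG by (auto simp: S_characters_over_def S_characters_def)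
    then show ?thesis unfolding V_sub_def by (rule generate.incl)
  qed
qed

lemma Delta_product_iff:
  assumes M: "subgroup M G"
  shows "Delta_product G (\<X>, \<Y>) M N \<longleftrightarrow>
    M \<subseteq> N \<and> (\<forall>Y\<in>\<Y>. Y \<inter> N = {} \<longrightarrow> (\<forall>m\<in>M. \<forall>y\<in>Y. m \<otimes> y \<in> Y))"
  unfolding Delta_product_def S_classes_def by (auto simp: union_of_cosets_iff[OF M class_subset])

text \<open>Outside \<open>N\<close>, only the \<open>S\<close>-characters with \<open>K\<close> in the kernel can be nonzero if
  \<open>V(S | K) \<le> N\<close>; these cannot distinguish the elements of a coset of \<open>K\<close>. Conversely, an
  \<open>S\<close>-character that is constant on a coset over which its sum is \<open>0\<close> vanishes there.\<close>

lemma V_sub_le_iff_Delta_product: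
  assumes K: "S_normal G (\<X>, \<Y>) K" and N: "S_normal G (\<X>, \<Y>) N"
  shows "V_sub G (\<X>, \<Y>) K \<subseteq> N \<longleftrightarrow> Delta_product G (\<X>, \<Y>) K N"
proof
  interpret N: subgroup N G by (rule S_normalD(1)[OF N])
  assume V: "V_sub G (\<X>, \<Y>) K \<subseteq> N"
  have KN: "K \<subseteq> N" using S_normal_le_V_sub[OF K] V by blast
  have van: "\<sigma> X g = 0"
    if "X \<in> \<X>" "g \<in> carrier G" "g \<notin> N" "\<not> K \<subseteq> char_kernel G (\<sigma> X)" for X g
    using V that unfolding V_sub_le_iff[OF S_normalD(1)[OF N]] by blast
  have "k \<otimes> g \<in> Y" if Y: "Y \<in> \<Y>" "Y \<inter> N = {}" and k: "k \<in> K" and g: "g \<in> Y" for Y k g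
  proof (rule sigma_separates_classes[OF Y(1) g])
    have G: "g \<in> carrier G" "k \<in> carrier G" and kN: "k \<in> N" and gN: "g \<notin> N"
      using Y g k KN class_subset[OF Y(1)] N.subset by auto
    then show kg: "k \<otimes> g \<in> carrier G" by simp
    have "k \<otimes> g \<notin> N"
    proof
      assume "k \<otimes> g \<in> N"
      then have "inv k \<otimes> (k \<otimes> g) \<in> N" using kN by simp
      then show False using G gN by (simp add: m_assoc[symmetric])
    qed
    then show "\<sigma> X (k \<otimes> g) = \<sigma> X g" if "X \<in> \<X>" for X
      using sigma_S_normal_dichotomy(1)[OF K that G(1) _ k] van[OF that G(1) gN] van[OF that kg]
      by (cases "K \<subseteq> char_kernel G (\<sigma> X)") auto
  qed
  then show "Delta_product G (\<X>, \<Y>) K N"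
    unfolding Delta_product_iff[OF S_normalD(1)[OF K]] using KN by blast
next
  assume D: "Delta_product G (\<X>, \<Y>) K N"
  show "V_sub G (\<X>, \<Y>) K \<subseteq> N"
    unfolding V_sub_le_iff[OF S_normalD(1)[OF N]]
  proof (intro ballI impI, rule ccontr)
    fix X g assume X: "X \<in> \<X>" and g: "g \<in> carrier G" and not: "\<not> K \<subseteq> char_kernel G (\<sigma> X)"
      and nz: "\<sigma> X g \<noteq> 0" and gN: "g \<notin> N"
    obtain Y where Y: "Y \<in> \<Y>" "g \<in> Y" using g carrier_eq by auto
    have "Y \<inter> N = {}" using S_normalD(4)[OF N Y(1)] Y gN by blast
    then have "k \<otimes> g \<in> Y" if "k \<in> K" for k
      using D Y that unfolding Delta_product_iff[OF S_normalD(1)[OF K]] by blast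
    then have "(\<Sum>k\<in>K. \<sigma> X (k \<otimes> g)) = (\<Sum>k\<in>K. \<sigma> X g)"
      using sigma_const[OF X Y(1) _ Y(2)] by (intro sum.cong) auto
    moreover have "card K > 0"
      using S_normalD(3)[OF K] subgroup.one_closed[OF S_normalD(1)[OF K]] card_gt_0_iff by blast
    ultimately show False using sigma_S_normal_dichotomy(2)[OF K X g not] nz by simp
  qed
qed

lemma U_sub_eq_generate:
  "U_sub G (\<X>, \<Y>) N = generate G (\<Union>{K. S_normal G (\<X>, \<Y>) K \<and> V_sub G (\<X>, \<Y>) K \<subseteq> N})"
proof -
  let ?F = "{K. S_normal G (\<X>, \<Y>) K \<and> V_sub G (\<X>, \<Y>) K \<subseteq> N}"
  have "?F \<subseteq> Pow (carrier G)" using S_normalD(2) by blast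
  then have fin: "finite ?F" by (rule finite_subset) (simp add: finite_carrier)
  obtain Ks where Ks: "set Ks = ?F" using finite_list[OF fin] ..
  have norm: "K \<lhd> G" if "K \<in> ?F" for K
    by (rule S_normal_imp_normal) (use that in simp)
  note norm = norm[folded Ks]
  show ?thesis
    unfolding U_sub_def Ks[symmetric]
    by (rule trans[OF subgroups_product_eq[OF norm] foldr_set_mult_normal(2)[OF norm]])
qed

text \<open>If \<open>Y\<close> is stable under left multiplication by a family of subgroups, then it is stable under the
  subgroup they generate. So the \<open>\<Delta>\<close>-property passes from the subgroups \<open>K\<close> that define \<open>U(S | N)\<close> to
  every subgroup of \<open>U(S | N)\<close>.\<close>

lemma le_U_sub_iff:
  assumes H: "S_normal G (\<X>, \<Y>) H" and N: "S_normal G (\<X>, \<Y>) N"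
  shows "H \<subseteq> U_sub G (\<X>, \<Y>) N \<longleftrightarrow> Delta_product G (\<X>, \<Y>) H N"
    and "U_sub G (\<X>, \<Y>) N \<subseteq> N"
proof -
  let ?F = "{K. S_normal G (\<X>, \<Y>) K \<and> V_sub G (\<X>, \<Y>) K \<subseteq> N}"
  have F: "K \<subseteq> carrier G" "K \<subseteq> N"
    "Y \<in> \<Y> \<Longrightarrow> Y \<inter> N = {} \<Longrightarrow> k \<in> K \<Longrightarrow> y \<in> Y \<Longrightarrow> k \<otimes> y \<in> Y"
    if "K \<in> ?F" for K Y k y
    using that V_sub_le_iff_Delta_product[OF _ N, of K] S_normalD(1,2)[of K]
      Delta_product_iff[of K N] by auto
  show U: "U_sub G (\<X>, \<Y>) N \<subseteq> N"
    unfolding U_sub_eq_generate using F(2) S_normalD(1)[OF N]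
    by (intro generate_subgroup_incl) auto
  have closed: "u \<otimes> y \<in> Y"
    if "Y \<in> \<Y>" "Y \<inter> N = {}" "u \<in> U_sub G (\<X>, \<Y>) N" "y \<in> Y" for Y u y
    using that(3,4) unfolding U_sub_eq_generate
  proof (induction arbitrary: y rule: generate.induct)
    case one
    then show ?case using class_subset[OF that(1)] by auto
  next
    case (incl k)
    then show ?case using F(3) that(1,2) by blast
  next
    case (inv k)
    then obtain K where K: "K \<in> ?F" "k \<in> K" by auto
    then have "inv k \<in> K" using S_normalD(1)[of K] subgroup.m_inv_closed by fastforce
    then show ?case using F(3)[OF K(1)] that(1,2) inv by blast
  next
    case (eng u v)
    have "\<Union>?F \<subseteq> carrier G" using F(1) by blast
    then have "u \<in> carrier G" "v \<in> carrier G" "y \<in> carrier G"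
      using generate_in_carrier eng class_subset[OF that(1)] by auto
    then show ?case using eng by (simp add: m_assoc)
  qed
  show "H \<subseteq> U_sub G (\<X>, \<Y>) N \<longleftrightarrow> Delta_product G (\<X>, \<Y>) H N"
  proof
    assume "H \<subseteq> U_sub G (\<X>, \<Y>) N"
    then show "Delta_product G (\<X>, \<Y>) H N"
      unfolding Delta_product_iff[OF S_normalD(1)[OF H]] using U closed by blast
  next
    assume "Delta_product G (\<X>, \<Y>) H N"
    then have "H \<in> ?F" using V_sub_le_iff_Delta_product[OF H N] H by simp
    then show "H \<subseteq> U_sub G (\<X>, \<Y>) N"
      unfolding U_sub_eq_generate using generate.incl[of _ "\<Union>?F" G] by blast
  qed
qed

end

theorem theorem1p3:
  fixes G :: "('a, 'b) monoid_scheme" and S :: "'a supchar_pair" and H N :: "'a set"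
  assumes "group G" and "finite (carrier G)"
    and "supercharacter_theory G S"
    and "S_normal G S H" and "S_normal G S N"
  shows "(H \<subseteq> U_sub G S N \<longleftrightarrow> Delta_product G S H N) \<and>
         (N = U_sub G S N \<longleftrightarrow> star_product G S N)"
proof -
  obtain \<X> \<Y> where S: "S = (\<X>, \<Y>)" by (cases S)
  interpret supercharacter_theory_group G \<X> \<Y>
    using assms(1,2,3) unfolding S
    by (intro supercharacter_theory_group.intro supercharacter_theory_group_axioms.intro)
  have "N = U_sub G S N \<longleftrightarrow> N \<subseteq> U_sub G S N"
    using le_U_sub_iff(2)[of N N] assms(5) unfolding S by blast
  also have "\<dots> \<longleftrightarrow> Delta_product G S N N"
    using le_U_sub_iff(1)[of N N] assms(5) unfolding S by blast
  also have "\<dots> \<longleftrightarrow> star_product G S N"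
    unfolding Delta_product_def star_product_def by simp
  finally show ?thesis
    using le_U_sub_iff(1)[of H N] assms(4,5) unfolding S by blast
qed

end
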